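(* Let $M$ be a once-punctured torus bundle over the circle whose monodromy is pseudo-Anosov, i.e. is given by a matrix $A\in SL(2,\mathbf{Z})$ with $|\operatorname{trace} A|>2$, and let $\Gamma$ be a layered ideal triangulation of $M$. Then $\Gamma$ admits an angle structure if and only if $\Gamma$ has no edges of degree 2.
   Context: An ideal triangulation of $M$ is a decomposition of $M$ into tetrahedra glued along faces and edges with all vertices removed. The degree of an edge of the triangulation is the number of tetrahedron edges (counted with multiplicity) identified to it. Layered ideal triangulation of a once-punctured torus bundle: start with an ideal triangulation of the once-punctured torus $T$ by two ideal triangles (with three edges). Attach an ideal tetrahedron so that two of its faces (adjacent along an edge) are glued onto the two triangles of $T$; the remaining two faces of the tetrahedron then form a new ideal triangulation of the once-punctured torus by two ideal triangles, obtained from the previous one by replacing one edge (a diagonal of the quadrilateral formed by the two triangles) by the other diagonal. Continue attaching finitely many tetrahedra in this way, each along two faces at a time, onto the two free faces of the previous one. Finally glue the last triangulated once-punctured torus to the initial one by a simplicial identification realising the monodromy, so that the result is an ideal triangulation of the bundle $M$. Angle structure: an assignment of strictly positive dihedral angles $\alpha,\beta,\gamma$ to the three pairs of opposite edges of each tetrahedron (opposite edges get the same angle) such that $\alpha+\beta+\gamma=\pi$ in each tetrahedron and the sum of all dihedral angles around each edge of the triangulation (counted with multiplicity) is $2\pi$. *)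

theory Defs
  imports "HOL-Analysis.Analysis"
begin

section \<open>Triangulations given by face pairings\<close>

datatype vertex = V0 | V1 | V2 | V3

text \<open>
  The face of a tetrahedron opposite the vertex \<open>v\<close> is named by the pair \<open>(t, v)\<close>.  If
  \<open>glue \<Gamma> t v = (t', \<sigma>)\<close>, then that face is glued to the face \<open>(t', \<sigma> v)\<close>, a vertex \<open>x \<noteq> v\<close>
  of the first face going to the vertex \<open>\<sigma> x\<close> of the second.  All vertices are removed
  (they are ideal), so no condition on vertex links is imposed.
\<close>

record 'a triangulation =
  tets :: "'a set"
  glue :: "'a \<Rightarrow> vertex \<Rightarrow> 'a \<times> (vertex \<Rightarrow> vertex)"

definition face_pairing :: "'a triangulation \<Rightarrow> bool" where
  "face_pairing \<Gamma> \<longleftrightarrow> finite (tets \<Gamma>) \<and>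
     (\<forall>t \<in> tets \<Gamma>. \<forall>v t' \<sigma>. glue \<Gamma> t v = (t', \<sigma>) \<longrightarrow>
        t' \<in> tets \<Gamma> \<and> bij \<sigma> \<and> (t', \<sigma> v) \<noteq> (t, v) \<and> glue \<Gamma> t' (\<sigma> v) = (t, inv \<sigma>))"

text \<open>An edge of a tetrahedron is a pair of vertices; the opposite edge is the complement.\<close>

definition tet_edges :: "vertex set set" where
  "tet_edges = {e. card e = 2}"

definition edge_glue :: "'a triangulation \<Rightarrow> (('a \<times> vertex set) \<times> ('a \<times> vertex set)) set" where
  "edge_glue \<Gamma> = {((t, e), (t', \<sigma> ` e)) | t e t' \<sigma> v.
     t \<in> tets \<Gamma> \<and> e \<in> tet_edges \<and> v \<notin> e \<and> glue \<Gamma> t v = (t', \<sigma>)}"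

text \<open>An edge of the triangulation is the class of all tetrahedron edges identified to it.\<close>

definition edges :: "'a triangulation \<Rightarrow> ('a \<times> vertex set) set set" where
  "edges \<Gamma> = (tets \<Gamma> \<times> tet_edges) // (edge_glue \<Gamma> \<union> (edge_glue \<Gamma>)\<inverse>)\<^sup>*"

definition edge_degree :: "('a \<times> vertex set) set \<Rightarrow> nat" where
  "edge_degree E = card E"

definition angle_structure :: "'a triangulation \<Rightarrow> ('a \<Rightarrow> vertex set \<Rightarrow> real) \<Rightarrow> bool" where
  "angle_structure \<Gamma> \<theta> \<longleftrightarrow>
     (\<forall>t \<in> tets \<Gamma>.
        (\<forall>e \<in> tet_edges. \<theta> t e > 0 \<and> \<theta> t (- e) = \<theta> t e) \<and>
        \<theta> t {V0, V1} + \<theta> t {V0, V2} + \<theta> t {V0, V3} = pi) \<and>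
     (\<forall>E \<in> edges \<Gamma>. (\<Sum>(t, e) \<in> E. \<theta> t e) = 2 * pi)"


section \<open>Layered triangulations of once-punctured torus bundles\<close>

text \<open>
  The once-punctured torus is \<open>(\<real>\<^sup>2 - \<int>\<^sup>2) / \<int>\<^sup>2\<close>, with mapping class group \<open>SL(2, \<int>)\<close>.  Up to
  isotopy its ideal triangulations are straight: they lift to \<open>\<int>\<^sup>2\<close>-periodic triangulations
  of the plane with vertex set \<open>\<int>\<^sup>2\<close>, whose triangles have unimodular edge vectors.
  A tetrahedron layered on such a triangulation is a flattened unimodular parallelogram,
  \<open>p x\<close> being the lattice point under the vertex \<open>x\<close> of a lift.  \<open>B\<close> is the bottom diagonal,
  i.e. the edge that is removed; the two bottom faces are those containing \<open>B\<close>, i.e. those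
  opposite a vertex outside \<open>B\<close>.  The top diagonal is \<open>- B\<close>, and the two top faces are those
  opposite a vertex in \<open>B\<close>.
\<close>

definition layer_tet :: "(vertex \<Rightarrow> int ^ 2) \<Rightarrow> vertex set \<Rightarrow> bool" where
  "layer_tet p B \<longleftrightarrow> (\<exists>a b c d. distinct [a, b, c, d] \<and> B = {a, c} \<and>
     p a + p c = p b + p d \<and> det (vector [p b - p a, p d - p a] :: int ^ 2 ^ 2) = 1)"

text \<open>
  The tetrahedra \<open>tet 0, \<dots>, tet (n - 1)\<close> are attached in this order, the top faces of each being
  glued to the bottom faces of the next by deck transformations of the plane, that is, by
  translations by lattice vectors \<open>w\<close>.  Index \<open>n\<close> stands again for the first tetrahedron, seen
  through the monodromy: its lattice points are the images under \<open>A\<close> of those at index \<open>0\<close>.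
  Hence the top triangulated torus is identified with the bottom one by the inverse of \<open>A\<close>.
  The bottom faces need no separate condition, because the face pairing is an involution.
\<close>

definition layered_bundle_triangulation :: "int ^ 2 ^ 2 \<Rightarrow> 'a triangulation \<Rightarrow> bool" where
  "layered_bundle_triangulation A \<Gamma> \<longleftrightarrow> face_pairing \<Gamma> \<and>
     (\<exists>(n :: nat) (tet :: nat \<Rightarrow> 'a) (p :: nat \<Rightarrow> vertex \<Rightarrow> int ^ 2) (B :: nat \<Rightarrow> vertex set).
        n > 0 \<and> bij_betw tet {..<n} (tets \<Gamma>) \<and>
        (\<forall>i<n. layer_tet (p i) (B i)) \<and>
        tet n = tet 0 \<and> B n = B 0 \<and> (\<forall>x. p n x = A *v p 0 x) \<and>
        (\<forall>i<n. \<forall>v \<in> B i. \<exists>\<sigma> w. glue \<Gamma> (tet i) v = (tet (Suc i), \<sigma>) \<and> \<sigma> v \<notin> B (Suc i) \<and>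
           (\<forall>x. x \<noteq> v \<longrightarrow> p (Suc i) (\<sigma> x) = p i x + w)))"

end

(*
  Unroll the layering to an infinite tower.  An edge of the triangulation is created as the top
  diagonal of one tetrahedron, persists as a side of the next ones, and disappears as the bottom
  diagonal of another; it has degree 2 iff that one comes immediately after the first.  Such an
  edge excludes angle structures since all angles are below pi.

  If this never happens, choose (after Gueritaud) an exterior angle w_k at the diagonals of the
  k-th tetrahedron, and bend the torus between the tetrahedra k and k + 1 so that the angle below
  its edges is pi - w_k, pi + w_{k+1} and pi + w_k - w_{k+1}.  The side angles of a tetrahedron are
  half the differences of these values on the tori above and below it, so the edge equations
  hold by telescoping and only positivity constrains w.  A periodic choice of w exists as soon as
  the path of triangulations turns somewhere, and otherwise A fixes a slope, so |trace A| = 2.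
*)
theory Submission
  imports Defs
begin

section \<open>Edges of a flattened tetrahedron and their slopes\<close>

lemma UNIV_vertex: "(UNIV :: vertex set) = {V0, V1, V2, V3}"
  using vertex.exhaust by auto

instance vertex :: finite
  by standard (simp add: UNIV_vertex)

lemma card_vertex: "CARD(vertex) = 4"
  unfolding UNIV_vertex by simp

lemma UNIV_vertex_distinct:
  assumes "distinct [a, b, c, d :: vertex]"
  shows "UNIV = {a, b, c, d}"
proof -
  have "card {a, b, c, d} = 4"
    using assms by simp
  then show ?thesis
    by (metis card_subset_eq card_vertex finite subset_UNIV)
qed

lemma tet_edges_distinct:
  assumes "distinct [a, b, c, d]"
  shows "tet_edges = {{a, b}, {a, c}, {a, d}, {b, c}, {b, d}, {c, d}}"
proof -
  have x: "x = a \<or> x = b \<or> x = c \<or> x = d" for x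
    using UNIV_vertex_distinct[OF assms] by auto
  show ?thesis
  proof (intro equalityI subsetI)
    fix e assume "e \<in> tet_edges"
    then obtain x y where "e = {x, y}" "x \<noteq> y"
      by (auto simp: tet_edges_def card_2_iff)
    then show "e \<in> {{a, b}, {a, c}, {a, d}, {b, c}, {b, d}, {c, d}}"
      using x[of x] x[of y] by (elim disjE) (simp_all add: insert_commute)
  qed (use assms in \<open>auto simp: tet_edges_def\<close>)
qed

lemma image_tet_edges:
  assumes "bij \<sigma>" "e \<in> tet_edges"
  shows "\<sigma> ` e \<in> tet_edges"
  using assms card_image[OF inj_on_subset[OF bij_is_inj subset_UNIV], of \<sigma> e]
  by (simp add: tet_edges_def)

lemma compl_tet_edges: "e \<in> tet_edges \<Longrightarrow> - e \<in> tet_edges"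
  by (simp add: tet_edges_def Compl_eq_Diff_UNIV card_Diff_subset card_vertex)

text \<open>Twice either side is the sum of \<open>f\<close> over all six edges, so the angle
  condition, stated at \<open>V0\<close>, may be checked with any labelling of the vertices.\<close>

lemma sum_opposite_edges:
  fixes f :: "vertex set \<Rightarrow> real"
  assumes "\<And>e. e \<in> tet_edges \<Longrightarrow> f (- e) = f e" and "distinct [a, b, c, d]"
  shows "f {V0, V1} + f {V0, V2} + f {V0, V3} = f {a, b} + f {a, c} + f {a, d}"
proof -
  have *: "(\<Sum>e\<in>tet_edges. f e) = 2 * (f {a, b} + f {a, c} + f {a, d})"
    if "distinct [a, b, c, d]" for a b c d
  proof -
    note U = UNIV_vertex_distinct[OF that]
    have "- {a, b} = {c, d}" "- {a, c} = {b, d}" "- {a, d} = {b, c}"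
      using that U by auto
    then have "f {c, d} = f {a, b}" "f {b, d} = f {a, c}" "f {b, c} = f {a, d}"
      using assms(1) tet_edges_distinct[OF that] by (metis insertI1 insertI2)+
    moreover have "(\<Sum>e\<in>tet_edges. f e)
        = f {a, b} + f {a, c} + f {a, d} + f {b, c} + f {b, d} + f {c, d}"
      using that unfolding tet_edges_distinct[OF that]
      by (subst sum.insert | simp add: doubleton_eq_iff | blast)+
    ultimately show ?thesis
      by simp
  qed
  show ?thesis
    using *[OF assms(2)] *[of V0 V1 V2 V3] by simp
qed

text \<open>A pair of opposite vectors forgets orientation and translation, so it depends only on
  the edge of the punctured torus that the segment projects to.\<close>

definition slope :: "(vertex \<Rightarrow> int ^ 2) \<Rightarrow> vertex set \<Rightarrow> (int ^ 2) set" where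
  "slope p e = {p x - p y |x y. e = {x, y}}"

lemma slope_doubleton: "slope p {x, y} = {p x - p y, p y - p x}"
  by (auto simp: slope_def doubleton_eq_iff)

text \<open>With side vectors u and v, the four slopes are u, v, u + v and u - v up to sign.
  Unimodularity makes u and v independent, hence the slopes distinct.\<close>

lemma layer_tetE:
  assumes "layer_tet p B"
  obtains a b c d r s where "distinct [a, b, c, d]" "B = {a, c}" "- B = {b, d}"
    "slope p {a, b} = r" "slope p {c, d} = r" "slope p {a, d} = s" "slope p {b, c} = s"
    "distinct [r, s, slope p {a, c}, slope p {b, d}]"
    "\<exists>x. x \<noteq> 0 \<and> r = {x, - x}" "\<exists>x. x \<noteq> 0 \<and> s = {x, - x}"
proof -
  obtain a b c d where abcd: "distinct [a, b, c, d]" "B = {a, c}" "p a + p c = p b + p d"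
    and det: "det (vector [p b - p a, p d - p a] :: int ^ 2 ^ 2) = 1"
    using assms unfolding layer_tet_def by blast
  define u v where "u = p b - p a" and "v = p d - p a"
  have uv: "u $ 1 * v $ 2 - u $ 2 * v $ 1 = 1"
    using det by (simp add: det_2 u_def v_def)
  have pc: "p c = p a + u + v" "p b = p a + u" "p d = p a + v"
    using abcd(3) by (auto simp: u_def v_def algebra_simps)
  have indep: "x = 0 \<and> y = 0"
    if "x * u $ 1 + y * v $ 1 = 0" "x * u $ 2 + y * v $ 2 = 0" for x y
  proof -
    \<comment> \<open>Cramer's rule with determinant 1.\<close>
    have "x = x * (u $ 1 * v $ 2 - u $ 2 * v $ 1)"
      using uv by simp
    also have "\<dots> = v $ 2 * (x * u $ 1 + y * v $ 1) - v $ 1 * (x * u $ 2 + y * v $ 2)"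
      by (simp add: algebra_simps)
    finally have "x = 0"
      by (simp only: that mult_zero_right diff_0_right)
    have "y = y * (u $ 1 * v $ 2 - u $ 2 * v $ 1)"
      using uv by simp
    also have "\<dots> = u $ 1 * (x * u $ 2 + y * v $ 2) - u $ 2 * (x * u $ 1 + y * v $ 1)"
      by (simp add: algebra_simps)
    finally have "y = 0"
      by (simp only: that mult_zero_right diff_0_right)
    with \<open>x = 0\<close> show ?thesis ..
  qed
  \<comment> \<open>Each equality would be a linear relation between \<open>u\<close> and
    \<open>v\<close>; its coefficients are those passed to \<open>indep\<close>.\<close>
  have ne: "u \<noteq> 0"
    "v \<noteq> 0"
    "u \<noteq> v"
    "u \<noteq> - v"
    "u \<noteq> u + v"
    "u \<noteq> - (u + v)"
    "u \<noteq> u - v"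
    "u \<noteq> - (u - v)"
    "v \<noteq> u + v"
    "v \<noteq> - (u + v)"
    "v \<noteq> u - v"
    "v \<noteq> - (u - v)"
    "u + v \<noteq> u - v"
    "u + v \<noteq> - (u - v)"
    subgoal using indep[of 1 0] by (auto simp: vec_eq_iff forall_2)
    subgoal using indep[of 0 1] by (auto simp: vec_eq_iff forall_2)
    subgoal using indep[of 1 "-1"] by (auto simp: vec_eq_iff forall_2)
    subgoal using indep[of 1 1] by (auto simp: vec_eq_iff forall_2)
    subgoal using indep[of 0 1] by (auto simp: vec_eq_iff forall_2)
    subgoal using indep[of 2 1] by (auto simp: vec_eq_iff forall_2)
    subgoal using indep[of 0 1] by (auto simp: vec_eq_iff forall_2)
    subgoal using indep[of 2 "-1"] by (auto simp: vec_eq_iff forall_2)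
    subgoal using indep[of 1 0] by (auto simp: vec_eq_iff forall_2)
    subgoal using indep[of 1 2] by (auto simp: vec_eq_iff forall_2)
    subgoal using indep[of 1 "-2"] by (auto simp: vec_eq_iff forall_2)
    subgoal using indep[of 1 0] by (auto simp: vec_eq_iff forall_2)
    subgoal using indep[of 0 2] by (auto simp: vec_eq_iff forall_2)
    subgoal using indep[of 2 0] by (auto simp: vec_eq_iff forall_2)
    done
  have "{x, - x} \<noteq> {y, - y}" if "x \<noteq> y" "x \<noteq> - y" for x y :: "int ^ 2"
    using that by blast
  with ne have "distinct [{u, - u}, {v, - v}, {u + v, - (u + v)}, {u - v, - (u - v)}]"
    unfolding distinct.simps list.set by blast
  moreover have "slope p {a, b} = {u, - u}" "slope p {c, d} = {u, - u}"
    "slope p {a, d} = {v, - v}" "slope p {b, c} = {v, - v}"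
    "slope p {a, c} = {u + v, - (u + v)}" "slope p {b, d} = {u - v, - (u - v)}"
    by (simp_all add: slope_doubleton pc insert_commute)
  moreover have "- B = {b, d}"
    using abcd(1) unfolding abcd(2) Compl_eq_Diff_UNIV UNIV_vertex_distinct[OF abcd(1)] by auto
  moreover have "\<exists>x. x \<noteq> 0 \<and> {u, - u} = {x, - x}"
    by (rule exI[of _ u]) (simp add: ne)
  moreover have "\<exists>x. x \<noteq> 0 \<and> {v, - v} = {x, - x}"
    by (rule exI[of _ v]) (simp add: ne)
  ultimately show thesis
    using abcd(1,2) by (intro that[of a b c d "{u, - u}" "{v, - v}"]) (simp_all only:)
qed

definition side_slopes :: "(vertex \<Rightarrow> int ^ 2) \<Rightarrow> vertex set \<Rightarrow> (int ^ 2) set set" where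
  "side_slopes p B = slope p ` {e \<in> tet_edges. e \<noteq> B \<and> e \<noteq> - B}"

text \<open>Gluings preserve slopes, so edges are recognised by them below: a slope determines
  either diagonal, and determines a side up to passing to the opposite one.\<close>

lemma layer_tet_slopes:
  assumes "layer_tet p B"
  shows layer_tet_diagonals: "B \<in> tet_edges" "- B \<in> tet_edges"
    and slope_opposite: "\<And>e. e \<in> tet_edges \<Longrightarrow> e \<noteq> B \<Longrightarrow> e \<noteq> - B \<Longrightarrow> slope p (- e) = slope p e"
    and slope_eq_bottom: "\<And>e. e \<in> tet_edges \<Longrightarrow> slope p e = slope p B \<longleftrightarrow> e = B"
    and slope_eq_top: "\<And>e. e \<in> tet_edges \<Longrightarrow> slope p e = slope p (- B) \<longleftrightarrow> e = - B"
    and card_side_slopes: "card (side_slopes p B) = 2"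
    and top_face_slopes: "\<And>v. v \<in> B \<Longrightarrow>
      slope p ` {e \<in> tet_edges. v \<notin> e} = insert (slope p (- B)) (side_slopes p B)"
    and bottom_face_slopes: "\<And>v. v \<notin> B \<Longrightarrow>
      slope p ` {e \<in> tet_edges. v \<notin> e} = insert (slope p B) (side_slopes p B)"
    and side_slopes_nonzero: "\<And>s. s \<in> side_slopes p B \<Longrightarrow> \<exists>x. x \<noteq> 0 \<and> s = {x, - x}"
proof -
  from assms obtain a b c d r s where *: "distinct [a, b, c, d]" "B = {a, c}" "- B = {b, d}"
    "slope p {a, b} = r" "slope p {c, d} = r" "slope p {a, d} = s" "slope p {b, c} = s"
    "distinct [r, s, slope p {a, c}, slope p {b, d}]"
    "\<exists>x. x \<noteq> 0 \<and> r = {x, - x}" "\<exists>x. x \<noteq> 0 \<and> s = {x, - x}"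
    by (rule layer_tetE)
  note E = tet_edges_distinct[OF *(1)]
  have U: "v = a \<or> v = b \<or> v = c \<or> v = d" for v
    using UNIV_vertex_distinct[OF *(1)] by auto
  have opp: "- {a, b} = {c, d}" "- {c, d} = {a, b}" "- {a, d} = {b, c}" "- {b, c} = {a, d}"
    using *(1) unfolding Compl_eq_Diff_UNIV UNIV_vertex_distinct[OF *(1)] by auto
  have sides: "{e \<in> tet_edges. e \<noteq> B \<and> e \<noteq> - B} = {{a, b}, {a, d}, {b, c}, {c, d}}"
  proof -
    have ne: "{a, b} \<noteq> B" "{a, d} \<noteq> B" "{b, c} \<noteq> B" "{c, d} \<noteq> B"
      "{a, b} \<noteq> - B" "{a, d} \<noteq> - B" "{b, c} \<noteq> - B" "{c, d} \<noteq> - B"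
      using *(1) unfolding *(3) unfolding *(2) doubleton_eq_iff by auto
    have T: "tet_edges = {B, - B, {a, b}, {a, d}, {b, c}, {c, d}}"
      unfolding *(3) E unfolding *(2) by (rule set_eqI) (simp only: insert_iff empty_iff disj_ac)
    show ?thesis
    proof (rule set_eqI)
      fix e
      show "e \<in> {e \<in> tet_edges. e \<noteq> B \<and> e \<noteq> - B} \<longleftrightarrow> e \<in> {{a, b}, {a, d}, {b, c}, {c, d}}"
        unfolding mem_Collect_eq T insert_iff empty_iff using ne by metis
    qed
  qed
  have S: "side_slopes p B = {r, s}"
    unfolding side_slopes_def sides by (auto simp: *(4-7))
  show "B \<in> tet_edges" "- B \<in> tet_edges"
    unfolding E *(3) unfolding *(2) by simp_all
  show "slope p (- e) = slope p e" if "e \<in> tet_edges" "e \<noteq> B" "e \<noteq> - B" for e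
  proof -
    have "e \<in> {{a, b}, {a, d}, {b, c}, {c, d}}"
      unfolding sides[symmetric] using that by simp
    then show ?thesis
      by (auto simp: opp *(4-7))
  qed
  have d: "r \<noteq> slope p B" "s \<noteq> slope p B" "r \<noteq> slope p (- B)" "s \<noteq> slope p (- B)"
    "slope p B \<noteq> slope p (- B)"
    using *(8) unfolding *(3) unfolding *(2) by simp_all
  have cases: "e = B \<or> e = - B \<or> slope p e = r \<or> slope p e = s" if "e \<in> tet_edges" for e
  proof (cases "e = B \<or> e = - B")
    case False
    then have "slope p e \<in> side_slopes p B"
      using that unfolding side_slopes_def by blast
    then show ?thesis
      unfolding S by blast
  qed blast
  show "slope p e = slope p B \<longleftrightarrow> e = B" if "e \<in> tet_edges" for e
    using cases[OF that] d by metis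
  show "slope p e = slope p (- B) \<longleftrightarrow> e = - B" if "e \<in> tet_edges" for e
    using cases[OF that] d by metis
  show "card (side_slopes p B) = 2"
    using *(8) unfolding S by simp
  have face: "{e \<in> tet_edges. a \<notin> e} = {{b, c}, {b, d}, {c, d}}"
    "{e \<in> tet_edges. b \<notin> e} = {{a, c}, {a, d}, {c, d}}"
    "{e \<in> tet_edges. c \<notin> e} = {{a, b}, {a, d}, {b, d}}"
    "{e \<in> tet_edges. d \<notin> e} = {{a, b}, {a, c}, {b, c}}"
    using *(1) unfolding E by auto
  show "slope p ` {e \<in> tet_edges. v \<notin> e} = insert (slope p (- B)) (side_slopes p B)"
    if "v \<in> B" for v
  proof -
    have "v = a \<or> v = c"
      using that *(2) by blast
    then show ?thesis
      unfolding S *(3) by (elim disjE) (simp_all add: face *(4-7) insert_commute)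
  qed
  show "slope p ` {e \<in> tet_edges. v \<notin> e} = insert (slope p B) (side_slopes p B)"
    if "v \<notin> B" for v
  proof -
    have "v = b \<or> v = d"
      using that *(2) U by blast
    then show ?thesis
      unfolding S unfolding *(2) by (elim disjE) (simp_all add: face *(4-7) insert_commute)
  qed
  show "\<exists>x. x \<noteq> 0 \<and> s = {x, - x}" if "s \<in> side_slopes p B" for s
    using that *(9,10) unfolding S by blast
qed

lemma diagonal_slopes_notin_side_slopes:
  assumes "layer_tet p B"
  shows "slope p B \<notin> side_slopes p B" "slope p (- B) \<notin> side_slopes p B"
  using slope_eq_bottom[OF assms] slope_eq_top[OF assms] unfolding side_slopes_def by force+

lemma layer_tet_mult:
  assumes "layer_tet p B" "det A = 1"
  shows "layer_tet (\<lambda>x. A *v p x) B"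
proof -
  have "det (vector [A *v q - A *v r, A *v s - A *v r] :: int ^ 2 ^ 2)
      = det A * det (vector [q - r, s - r] :: int ^ 2 ^ 2)" for q r s :: "int ^ 2"
    by (simp add: det_2 matrix_vector_mult_def sum_2 algebra_simps)
  then show ?thesis
    using assms unfolding layer_tet_def by (metis matrix_vector_right_distrib mult_1)
qed

section \<open>The unrolled layering\<close>

text \<open>The threshold \<open>m\<close> serves \<open>flag\<close>, whose periodicity is
  established only beyond a hinge.\<close>

lemma periodic_from_cong:
  fixes n :: nat
  assumes periodic: "\<And>k. k \<ge> m \<Longrightarrow> f (k + n) = f k"
    and "k \<ge> m" "l \<ge> m" "k mod n = l mod n"
  shows "f k = f l"
proof -
  have add: "f (k + q * n) = f k" if "k \<ge> m" for k q
  proof (induction q)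
    case (Suc q)
    then show ?case
      using periodic[of "k + q * n"] that by (simp add: ac_simps)
  qed simp
  have "f k = f l" if le: "k \<le> l" and "k \<ge> m" "k mod n = l mod n" for k l
  proof -
    have "n dvd l - k"
      using that mod_eq_dvd_iff_nat[of k l n] by simp
    then obtain q where "l = k + q * n"
      using le by (metis dvdE le_add_diff_inverse mult.commute)
    then show ?thesis
      using add that by simp
  qed
  then show ?thesis
    using assms(2-4) by (metis nat_le_linear)
qed

text \<open>
  The data of a layered triangulation, unrolled to an infinite tower of tetrahedra: the whole
  sequence is a lift to the infinite cyclic cover, whose deck transformation acts by \<open>A\<close>.
\<close>

locale layered_torus =
  fixes \<Gamma> :: "'a triangulation" and n :: nat and tet :: "nat \<Rightarrow> 'a"
    and p :: "nat \<Rightarrow> vertex \<Rightarrow> int ^ 2" and B :: "nat \<Rightarrow> vertex set" and A :: "int ^ 2 ^ 2"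
  assumes pairing: "face_pairing \<Gamma>"
    and n_pos: "n > 0"
    and tet_eq_iff: "tet k = tet l \<longleftrightarrow> k mod n = l mod n"
    and range_tet: "range tet = tets \<Gamma>"
    and layer: "layer_tet (p k) (B k)"
    and B_periodic: "B (k + n) = B k"
    and p_periodic: "p (k + n) x = A *v p k x"
    and glue_up: "v \<in> B k \<Longrightarrow> \<exists>\<sigma> w. glue \<Gamma> (tet k) v = (tet (Suc k), \<sigma>) \<and> \<sigma> v \<notin> B (Suc k) \<and>
      (\<forall>x. x \<noteq> v \<longrightarrow> p (Suc k) (\<sigma> x) = p k x + w)"
    and det_A: "det A = 1"
begin

abbreviation "bottom_slope k \<equiv> slope (p k) (B k)"
abbreviation "top_slope k \<equiv> slope (p k) (- B k)"
abbreviation "sides k \<equiv> side_slopes (p k) (B k)"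

lemma tet_in_tets [simp]: "tet k \<in> tets \<Gamma>"
  using range_tet by blast

lemma tet_Suc_eq_iff: "tet (Suc k) = tet (Suc l) \<longleftrightarrow> tet k = tet l"
  using n_pos by (auto simp: tet_eq_iff mod_Suc split: if_splits)

lemma B_cong: "tet k = tet l \<Longrightarrow> B k = B l"
  using periodic_from_cong[of 0 B n k l] by (simp add: B_periodic tet_eq_iff)

lemma B_nonempty: "\<exists>v. v \<in> B k"
  using layer_tet_diagonals(1)[OF layer, of k] by (fastforce simp: tet_edges_def card_2_iff)

lemma B_ne_compl [simp]: "B k \<noteq> - B l" if "tet k = tet l"
  using B_nonempty[of k] B_cong[OF that] by auto

section \<open>Gluings from one layer to the next\<close>

lemma glue_pairing:
  assumes "t \<in> tets \<Gamma>" "glue \<Gamma> t v = (t', \<sigma>)"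
  shows "t' \<in> tets \<Gamma>" "bij \<sigma>" "glue \<Gamma> t' (\<sigma> v) = (t, inv \<sigma>)"
  using pairing assms unfolding face_pairing_def by blast+

definition up_step :: "nat \<Rightarrow> vertex set \<Rightarrow> vertex set \<Rightarrow> bool" where
  "up_step k e e' \<longleftrightarrow> e \<in> tet_edges \<and>
    (\<exists>v \<sigma>. v \<in> B k \<and> v \<notin> e \<and> glue \<Gamma> (tet k) v = (tet (Suc k), \<sigma>) \<and> e' = \<sigma> ` e)"

lemma up_glueD:
  assumes "v \<in> B k" "glue \<Gamma> (tet k) v = (t', \<sigma>)"
  shows "t' = tet (Suc k)" "bij \<sigma>" "\<sigma> v \<notin> B (Suc k)"
    "\<And>e. e \<in> tet_edges \<Longrightarrow> v \<notin> e \<Longrightarrow> slope (p (Suc k)) (\<sigma> ` e) = slope (p k) e"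
proof -
  obtain w where w: "t' = tet (Suc k)" "\<sigma> v \<notin> B (Suc k)"
    "\<And>x. x \<noteq> v \<Longrightarrow> p (Suc k) (\<sigma> x) = p k x + w"
    using glue_up[OF assms(1)] assms(2) by auto
  show "t' = tet (Suc k)" "\<sigma> v \<notin> B (Suc k)"
    by fact+
  show "bij \<sigma>"
    using glue_pairing[OF tet_in_tets assms(2)] by simp
  fix e assume "e \<in> tet_edges" "v \<notin> e"
  then obtain x y where "e = {x, y}" "x \<noteq> v" "y \<noteq> v"
    by (auto simp: tet_edges_def card_2_iff)
  then show "slope (p (Suc k)) (\<sigma> ` e) = slope (p k) e"
    by (simp add: slope_doubleton w)
qed

text \<open>The bottom diagonal lies in no top face and the top diagonal in no bottom face; slopes
  survive because the gluing is a translation.\<close>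

lemma up_stepD:
  assumes "up_step k e e'"
  shows "e \<in> tet_edges" "e' \<in> tet_edges" "slope (p (Suc k)) e' = slope (p k) e"
    "e \<noteq> B k" "e' \<noteq> - B (Suc k)"
proof -
  obtain v \<sigma> where e: "e \<in> tet_edges" and v: "v \<in> B k" "v \<notin> e"
    and g: "glue \<Gamma> (tet k) v = (tet (Suc k), \<sigma>)" and e': "e' = \<sigma> ` e"
    using assms unfolding up_step_def by blast
  note \<sigma> = up_glueD[OF v(1) g]
  show "e \<in> tet_edges" "e' \<in> tet_edges" "slope (p (Suc k)) e' = slope (p k) e" "e \<noteq> B k"
    using e v \<sigma> by (auto simp: e' image_tet_edges)
  have "\<sigma> v \<notin> e'"
    using v(2) \<sigma>(2) unfolding e' by (simp add: inj_image_mem_iff bij_is_inj)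
  then show "e' \<noteq> - B (Suc k)"
    using \<sigma>(3) by blast
qed

text \<open>The face pairing sends the two top faces of layer \<open>k\<close> injectively into the
  two bottom faces of the next layer, hence onto them.\<close>

lemma bottom_face_is_glued_up:
  assumes "u \<notin> B (Suc k)"
  obtains v \<sigma> where "v \<in> B k" "glue \<Gamma> (tet k) v = (tet (Suc k), \<sigma>)" "\<sigma> v = u"
proof -
  define f where "f v = snd (glue \<Gamma> (tet k) v) v" for v
  have f: "\<exists>\<sigma>. glue \<Gamma> (tet k) v = (tet (Suc k), \<sigma>) \<and> f v = \<sigma> v \<and> f v \<notin> B (Suc k)"
    if "v \<in> B k" for v
    using glue_up[OF that] by (auto simp: f_def)
  have "inj_on f (B k)"
  proof (rule inj_onI)
    fix v v' assume vv': "v \<in> B k" "v' \<in> B k" "f v = f v'"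
    obtain \<sigma> \<sigma>' where g: "glue \<Gamma> (tet k) v = (tet (Suc k), \<sigma>)" "f v = \<sigma> v"
      "glue \<Gamma> (tet k) v' = (tet (Suc k), \<sigma>')" "f v' = \<sigma>' v'"
      using f vv' by metis
    have "inv \<sigma> = inv \<sigma>'"
      using glue_pairing(3)[OF tet_in_tets g(1)] glue_pairing(3)[OF tet_in_tets g(3)] g(2,4) vv'(3)
      by simp
    then have "inv \<sigma> (\<sigma> v) = inv \<sigma>' (\<sigma>' v')"
      using g(2,4) vv'(3) by simp
    then show "v = v'"
      using glue_pairing(2)[OF tet_in_tets g(1)] glue_pairing(2)[OF tet_in_tets g(3)]
      by (simp add: bij_is_inj)
  qed
  moreover have "card (B k) = card (- B (Suc k))"
    using layer_tet_diagonals[OF layer] by (simp add: tet_edges_def)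
  moreover have "f ` B k \<subseteq> - B (Suc k)"
    using f by auto
  ultimately have "f ` B k = - B (Suc k)"
    by (metis card_image card_subset_eq finite)
  then obtain v where "v \<in> B k" "f v = u"
    using assms by (metis ComplI imageE)
  then show thesis
    using f that by metis
qed

text \<open>Adding full turns of \<open>n\<close> layers gives every tetrahedron an index that is a
  successor and lies beyond any prescribed height.\<close>

lemma tet_predecessor:
  obtains j where "Suc j \<ge> m" "tet (Suc j) = tet k" "B (Suc j) = B k"
proof -
  have "Suc m * n \<ge> Suc m"
    using n_pos by (metis Suc_leI mult.right_neutral mult_le_mono2 One_nat_def)
  then obtain j where j: "Suc j = k + Suc m * n"
    by (metis Suc_le_D add_Suc_right nat_le_iff_add add.commute)
  then have "tet (Suc j) = tet k"
    by (simp only: tet_eq_iff mod_mult_self1)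
  moreover have "Suc j \<ge> m"
    using j \<open>Suc m * n \<ge> Suc m\<close> by linarith
  ultimately show thesis
    using that B_cong by blast
qed

section \<open>Edge classes generated by upward gluings\<close>

definition up_edges :: "(('a \<times> vertex set) \<times> ('a \<times> vertex set)) set" where
  "up_edges = {((tet k, e), (tet (Suc k), e')) |k e e'. up_step k e e'}"

lemma up_stepI:
  assumes "e \<in> tet_edges" "v \<in> B k" "v \<notin> e" "glue \<Gamma> (tet k) v = (t', \<sigma>)"
  shows "up_step k e (\<sigma> ` e)"
  unfolding up_step_def
proof (intro conjI exI[of _ v] exI[of _ \<sigma>])
  show "glue \<Gamma> (tet k) v = (tet (Suc k), \<sigma>)"
    using up_glueD(1)[OF assms(2,4)] assms(4) by simp
qed (use assms in simp_all)

lemma up_edgesI: "up_step k e e' \<Longrightarrow> ((tet k, e), (tet (Suc k), e')) \<in> up_edges"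
  unfolding up_edges_def by (intro CollectI exI[of _ k] exI[of _ e] exI[of _ e']) simp

text \<open>Every face is a top or a bottom face, and crossing a bottom face reverses the crossing
  of a top face one layer below.\<close>

lemma edge_glue_eq_up_edges: "edge_glue \<Gamma> \<union> (edge_glue \<Gamma>)\<inverse> = up_edges \<union> up_edges\<inverse>"
proof
  have "up_edges \<subseteq> edge_glue \<Gamma>"
  proof
    fix z assume "z \<in> up_edges"
    then obtain k e v \<sigma> where "z = ((tet k, e), (tet (Suc k), \<sigma> ` e))" "e \<in> tet_edges" "v \<notin> e"
      "glue \<Gamma> (tet k) v = (tet (Suc k), \<sigma>)"
      unfolding up_edges_def up_step_def by blast
    then show "z \<in> edge_glue \<Gamma>"
      unfolding edge_glue_def
      by (intro CollectI exI[of _ "tet k"] exI[of _ e] exI[of _ "tet (Suc k)"] exI[of _ \<sigma>] exI[of _ v])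
        simp
  qed
  then show "up_edges \<union> up_edges\<inverse> \<subseteq> edge_glue \<Gamma> \<union> (edge_glue \<Gamma>)\<inverse>"
    by blast
  have "((t, e), (t', \<sigma> ` e)) \<in> up_edges \<union> up_edges\<inverse>"
    if "t \<in> tets \<Gamma>" "e \<in> tet_edges" "v \<notin> e" "glue \<Gamma> t v = (t', \<sigma>)" for t e t' \<sigma> v
  proof -
    have "t \<in> range tet"
      using that(1) by (simp only: range_tet)
    then obtain l where l: "t = tet l"
      by (rule rangeE)
    obtain k where k: "tet (Suc k) = t" "B (Suc k) = B l"
      unfolding l by (rule tet_predecessor[of 0 l])
    show ?thesis
    proof (cases "v \<in> B l")
      case True
      have g: "glue \<Gamma> (tet l) v = (t', \<sigma>)"
        using that(4) l by simp
      show ?thesis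
        using up_edgesI[OF up_stepI[OF that(2) True that(3) g]] up_glueD(1)[OF True g] l by simp
    next
      case False
      then obtain u \<tau> where u: "u \<in> B k" "glue \<Gamma> (tet k) u = (tet (Suc k), \<tau>)" "\<tau> u = v"
        using bottom_face_is_glued_up[of v k] k(2) by auto
      have \<tau>: "bij \<tau>"
        using glue_pairing(2)[OF tet_in_tets u(2)] .
      have "t' = tet k" "\<sigma> = inv \<tau>"
        using glue_pairing(3)[OF tet_in_tets u(2)] that(4) k u(3) by auto
      have "\<tau> ` inv \<tau> ` e = e"
        using \<tau> by (simp add: image_f_inv_f bij_is_surj)
      have "u \<notin> inv \<tau> ` e"
      proof
        assume "u \<in> inv \<tau> ` e"
        then have "\<tau> u \<in> \<tau> ` inv \<tau> ` e"
          by (rule imageI)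
        then show False
          using that(3) u(3) \<open>\<tau> ` inv \<tau> ` e = e\<close> by simp
      qed
      moreover have "inv \<tau> ` e \<in> tet_edges"
        using that(2) \<tau> by (simp add: image_tet_edges bij_imp_bij_inv)
      ultimately have "up_step k (\<sigma> ` e) e"
        using up_stepI[OF _ u(1) _ u(2), of "inv \<tau> ` e"] \<open>\<tau> ` inv \<tau> ` e = e\<close> \<open>\<sigma> = inv \<tau>\<close>
        by simp
      then show ?thesis
        using up_edgesI[of k "\<sigma> ` e" e] \<open>t' = tet k\<close> k(1) by simp
    qed
  qed
  then have "edge_glue \<Gamma> \<subseteq> up_edges \<union> up_edges\<inverse>"
    unfolding edge_glue_def by blast
  then show "edge_glue \<Gamma> \<union> (edge_glue \<Gamma>)\<inverse> \<subseteq> up_edges \<union> up_edges\<inverse>"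
    by blast
qed

lemma edgesE:
  assumes "E \<in> edges \<Gamma>"
  obtains x where "x \<in> tets \<Gamma> \<times> tet_edges" "E = (up_edges \<union> up_edges\<inverse>)\<^sup>* `` {x}"
  using assms unfolding edges_def edge_glue_eq_up_edges by (rule quotientE)

lemma edge_subset:
  assumes "E \<in> edges \<Gamma>"
  shows "E \<subseteq> tets \<Gamma> \<times> tet_edges"
proof -
  obtain x where x: "x \<in> tets \<Gamma> \<times> tet_edges" "E = (up_edges \<union> up_edges\<inverse>)\<^sup>* `` {x}"
    using assms by (rule edgesE)
  have "(x, y) \<in> (up_edges \<union> up_edges\<inverse>)\<^sup>* \<Longrightarrow> y \<in> tets \<Gamma> \<times> tet_edges" for y
  proof (induction rule: rtrancl_induct)
    case (step y z)
    then show ?case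
      by (auto simp: up_edges_def dest: up_stepD)
  qed (fact x)
  then show ?thesis
    using x by auto
qed

lemma edge_closed:
  assumes "E \<in> edges \<Gamma>" "x \<in> E" "(x, y) \<in> edge_glue \<Gamma>"
  shows "y \<in> E"
proof -
  obtain z where E: "E = (edge_glue \<Gamma> \<union> (edge_glue \<Gamma>)\<inverse>)\<^sup>* `` {z}"
    using assms(1) unfolding edges_def by (rule quotientE)
  then have "(z, x) \<in> (edge_glue \<Gamma> \<union> (edge_glue \<Gamma>)\<inverse>)\<^sup>*"
    using assms(2) by simp
  then have "(z, y) \<in> (edge_glue \<Gamma> \<union> (edge_glue \<Gamma>)\<inverse>)\<^sup>*"
    using assms(3) by (meson UnI1 rtrancl.rtrancl_into_rtrancl)
  then show ?thesis
    by (simp add: E)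
qed

lemma finite_edge: "E \<in> edges \<Gamma> \<Longrightarrow> finite E"
proof -
  have "finite (tets \<Gamma>)"
    using pairing by (simp add: face_pairing_def)
  moreover have "finite tet_edges"
    by simp
  ultimately show "E \<in> edges \<Gamma> \<Longrightarrow> finite E"
    using edge_subset finite_subset by blast
qed

lemma edge_invariant:
  assumes "\<And>k e e'. up_step k e e' \<Longrightarrow> f (tet k, e) = f (tet (Suc k), e')"
    and "E \<in> edges \<Gamma>" "x \<in> E" "y \<in> E"
  shows "f x = f y"
proof -
  obtain z where E: "E = (up_edges \<union> up_edges\<inverse>)\<^sup>* `` {z}"
    using assms(2) by (rule edgesE)
  have "f z = f y" if "y \<in> E" for y
  proof -
    have "(z, y) \<in> (up_edges \<union> up_edges\<inverse>)\<^sup>*"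
      using that E by simp
    then show ?thesis
    proof (induction rule: rtrancl_induct)
      case (step x y)
      then show ?case
        using assms(1) by (auto simp: up_edges_def)
    qed simp
  qed
  then show ?thesis
    using assms(3,4) by metis
qed


section \<open>The action of the monodromy on slopes\<close>

definition act :: "(int ^ 2) set \<Rightarrow> (int ^ 2) set" where
  "act s = (\<lambda>x. A *v x) ` s"

lemma A_kernel: "A *v x = 0 \<Longrightarrow> x = 0"
proof -
  assume "A *v x = 0"
  then have z: "A $ 1 $ 1 * x $ 1 + A $ 1 $ 2 * x $ 2 = 0" "A $ 2 $ 1 * x $ 1 + A $ 2 $ 2 * x $ 2 = 0"
    by (simp_all add: matrix_vector_mult_def sum_2 vec_eq_iff forall_2)
  have "x $ 1 = det A * x $ 1" "x $ 2 = det A * x $ 2"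
    using det_A by simp_all
  \<comment> \<open>Both coordinates of \<open>A *v x\<close>, multiplied by the adjugate of
    \<open>A\<close>.\<close>
  moreover have
    "det A * x $ 1 = A $ 2 $ 2 * (A $ 1 $ 1 * x $ 1 + A $ 1 $ 2 * x $ 2)
       - A $ 1 $ 2 * (A $ 2 $ 1 * x $ 1 + A $ 2 $ 2 * x $ 2)"
    "det A * x $ 2 = A $ 1 $ 1 * (A $ 2 $ 1 * x $ 1 + A $ 2 $ 2 * x $ 2)
       - A $ 2 $ 1 * (A $ 1 $ 1 * x $ 1 + A $ 1 $ 2 * x $ 2)"
    by (simp_all add: det_2 algebra_simps)
  ultimately have "x $ 1 = 0" "x $ 2 = 0"
    unfolding z by simp_all
  then show "x = 0"
    by (simp add: vec_eq_iff forall_2)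
qed

lemma act_eq_iff [simp]: "act s = act s' \<longleftrightarrow> s = s'"
proof -
  have "inj (\<lambda>x. A *v x)"
    using A_kernel by (auto intro!: injI) (metis eq_iff_diff_eq_0 matrix_vector_mult_diff_distrib)
  then show ?thesis
    unfolding act_def by (rule inj_image_eq_iff)
qed

lemma slope_periodic: "slope (p (k + n)) e = act (slope (p k) e)"
  unfolding slope_def act_def p_periodic
  by (force simp: matrix_vector_mult_diff_distrib)

lemma bottom_periodic: "bottom_slope (k + n) = act (bottom_slope k)"
  and top_periodic: "top_slope (k + n) = act (top_slope k)"
  and sides_periodic: "sides (k + n) = act ` sides k"
  by (simp_all add: B_periodic slope_periodic side_slopes_def image_image)


text \<open>A top face and the bottom face glued to it both show the three slopes of the torus in
  between.\<close>

lemma sides_step: "insert (top_slope k) (sides k) = insert (bottom_slope (Suc k)) (sides (Suc k))"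
proof -
  obtain v where v: "v \<in> B k"
    using B_nonempty by blast
  obtain t' \<sigma> where g: "glue \<Gamma> (tet k) v = (t', \<sigma>)"
    by fastforce
  note \<sigma> = up_glueD[OF v g]
  have "{e \<in> tet_edges. \<sigma> v \<notin> e} = (`) \<sigma> ` {e \<in> tet_edges. v \<notin> e}"
  proof (intro equalityI subsetI)
    fix e assume e: "e \<in> {e \<in> tet_edges. \<sigma> v \<notin> e}"
    have \<sigma>e: "\<sigma> ` inv \<sigma> ` e = e"
      using \<sigma>(2) by (simp add: image_f_inv_f bij_is_surj)
    moreover have "v \<notin> inv \<sigma> ` e"
    proof
      assume "v \<in> inv \<sigma> ` e"
      then have "\<sigma> v \<in> \<sigma> ` inv \<sigma> ` e"
        by (rule imageI)
      then show False
        using e \<sigma>e by simp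
    qed
    moreover have "inv \<sigma> ` e \<in> tet_edges"
      using e \<sigma>(2) by (simp add: image_tet_edges bij_imp_bij_inv)
    ultimately show "e \<in> (`) \<sigma> ` {e \<in> tet_edges. v \<notin> e}"
      by (intro image_eqI[of _ _ "inv \<sigma> ` e"]) simp_all
  next
    fix e assume "e \<in> (`) \<sigma> ` {e \<in> tet_edges. v \<notin> e}"
    then show "e \<in> {e \<in> tet_edges. \<sigma> v \<notin> e}"
      by (auto simp: image_tet_edges \<sigma>(2) dest: injD[OF bij_is_inj[OF \<sigma>(2)]])
  qed
  then have "slope (p (Suc k)) ` {e \<in> tet_edges. \<sigma> v \<notin> e} = slope (p k) ` {e \<in> tet_edges. v \<notin> e}"
    using \<sigma>(4) by (simp add: image_image cong: image_cong_simp)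
  then show ?thesis
    unfolding top_face_slopes[OF layer v] bottom_face_slopes[OF layer \<sigma>(3)] by simp
qed


section \<open>Backtracking layers\<close>

lemma backtrack_periodic:
  "top_slope (k + n) = bottom_slope (Suc (k + n)) \<longleftrightarrow> top_slope k = bottom_slope (Suc k)"
  using top_periodic[of k] bottom_periodic[of "Suc k"] by simp

lemma backtrack_cong:
  assumes "tet k = tet l"
  shows "top_slope k = bottom_slope (Suc k) \<longleftrightarrow> top_slope l = bottom_slope (Suc l)"
  using periodic_from_cong[of 0 "\<lambda>k. top_slope k = bottom_slope (Suc k)" n k l]
    backtrack_periodic assms by (simp add: tet_eq_iff)

text \<open>The slope created by layer \<open>k\<close> is removed at once by the next layer. Since
  slopes identify diagonals, these two tetrahedron edges are linked only to each other.\<close>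

lemma up_edges_backtrack:
  assumes "top_slope k = bottom_slope (Suc k)" "(x, y) \<in> up_edges"
  shows "x = (tet k, - B k) \<longleftrightarrow> y = (tet (Suc k), B (Suc k))"
    and "y \<noteq> (tet k, - B k)" and "x \<noteq> (tet (Suc k), B (Suc k))"
proof -
  obtain j e e' where x: "x = (tet j, e)" and y: "y = (tet (Suc j), e')" and up: "up_step j e e'"
    using assms(2) unfolding up_edges_def by blast
  show "x = (tet k, - B k) \<longleftrightarrow> y = (tet (Suc k), B (Suc k))"
  proof (cases "tet j = tet k")
    case True
    then have eqs: "tet (Suc j) = tet (Suc k)" "B j = B k" "B (Suc j) = B (Suc k)"
      using B_cong tet_Suc_eq_iff by blast+
    have bt: "top_slope j = bottom_slope (Suc j)"
      using backtrack_cong[OF True] assms(1) by simp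
    have "e = - B j \<longleftrightarrow> slope (p j) e = top_slope j"
      using slope_eq_top[OF layer up_stepD(1)[OF up]] by simp
    also have "\<dots> \<longleftrightarrow> slope (p (Suc j)) e' = bottom_slope (Suc j)"
      using up_stepD(3)[OF up] bt by simp
    also have "\<dots> \<longleftrightarrow> e' = B (Suc j)"
      using slope_eq_bottom[OF layer up_stepD(2)[OF up]] by simp
    finally show ?thesis
      using True eqs by (simp add: x y)
  next
    case False
    then show ?thesis
      by (simp add: x y tet_Suc_eq_iff)
  qed
  show "y \<noteq> (tet k, - B k)"
    using up_stepD(5)[OF up] B_cong[of "Suc j" k] by (auto simp: y)
  show "x \<noteq> (tet (Suc k), B (Suc k))"
    using up_stepD(4)[OF up] B_cong[of j "Suc k"] by (auto simp: x)
qed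

lemma degree_2_edge_if_backtrack:
  assumes "top_slope k = bottom_slope (Suc k)"
  shows "\<exists>E \<in> edges \<Gamma>. edge_degree E = 2"
proof -
  let ?x = "(tet k, - B k)" and ?y = "(tet (Suc k), B (Suc k))"
  let ?R = "(up_edges \<union> up_edges\<inverse>)\<^sup>*"
  note bt = up_edges_backtrack[OF assms]
  obtain v where v: "v \<in> B k"
    using B_nonempty by blast
  obtain t' \<sigma> where g: "glue \<Gamma> (tet k) v = (t', \<sigma>)"
    by fastforce
  have "up_step k (- B k) (\<sigma> ` (- B k))"
    using up_stepI[OF layer_tet_diagonals(2)[OF layer] v _ g] v by simp
  then have "(?x, (tet (Suc k), \<sigma> ` (- B k))) \<in> up_edges"
    by (rule up_edgesI)
  with bt(1) have xy: "(?x, ?y) \<in> up_edges"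
    by metis
  have "?R `` {?x} = {?x, ?y}"
  proof (intro equalityI subsetI)
    fix z assume "z \<in> ?R `` {?x}"
    then have "(?x, z) \<in> ?R"
      by simp
    then show "z \<in> {?x, ?y}"
    proof (induction rule: rtrancl_induct)
      case (step z z')
      then have "z = ?x \<or> z = ?y" "(z, z') \<in> up_edges \<or> (z', z) \<in> up_edges"
        by blast+
      then have "z' = ?x \<or> z' = ?y"
        using bt by metis
      then show ?case
        by simp
    qed simp
  next
    fix z assume "z \<in> {?x, ?y}"
    then show "z \<in> ?R `` {?x}"
      using xy by auto
  qed
  moreover have "?R `` {?x} \<in> edges \<Gamma>"
    unfolding edges_def edge_glue_eq_up_edges
    by (rule quotientI) (simp add: layer_tet_diagonals[OF layer])
  \<comment> \<open>This matters when \<open>n = 1\<close>, where both edges lie in the same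
    tetrahedron.\<close>
  moreover have "?x \<noteq> ?y"
    using bt(2)[OF xy] by metis
  ultimately show ?thesis
    unfolding edge_degree_def by (metis card_2_iff)
qed


section \<open>Each edge is the bottom diagonal of exactly one tetrahedron\<close>

definition dies_at :: "nat \<Rightarrow> vertex set \<Rightarrow> nat \<Rightarrow> bool" where
  "dies_at k e m \<longleftrightarrow> k \<le> m \<and> bottom_slope m = slope (p k) e \<and>
     (\<forall>j. k \<le> j \<and> j < m \<longrightarrow> bottom_slope j \<noteq> slope (p k) e)"

text \<open>At most one element; as a set it may be empty, so that existence can be left open.
  Reduction modulo \<open>n\<close> makes it an invariant of the edges of \<Gamma> and not just of
  the tower.\<close>

definition death :: "nat \<Rightarrow> vertex set \<Rightarrow> nat set" where
  "death k e = {m mod n |m. dies_at k e m}"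

lemma dies_at_shift: "dies_at (k + n) e (m + n) \<longleftrightarrow> dies_at k e m"
proof -
  have "(\<forall>j. k + n \<le> j \<and> j < m + n \<longrightarrow> P j) \<longleftrightarrow> (\<forall>j. k \<le> j \<and> j < m \<longrightarrow> P (j + n))" for P
  proof (intro iffI allI impI)
    fix j assume *: "\<forall>j. k \<le> j \<and> j < m \<longrightarrow> P (j + n)" "k + n \<le> j \<and> j < m + n"
    have "P ((j - n) + n)"
      by (rule *(1)[rule_format]) (use *(2) in linarith)
    then show "P j"
      using *(2) by simp
  qed simp
  then show ?thesis
    unfolding dies_at_def by (simp add: B_periodic slope_periodic)
qed

lemma death_periodic: "death (k + n) = death k"
proof
  fix e
  have "r \<in> death (k + n) e \<longleftrightarrow> r \<in> death k e" for r
  proof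
    assume "r \<in> death (k + n) e"
    then obtain m where m: "dies_at (k + n) e m" "r = m mod n"
      unfolding death_def by blast
    then have "m = (m - n) + n"
      unfolding dies_at_def by simp
    then have "dies_at k e (m - n)" "r = (m - n) mod n"
      using m dies_at_shift by (metis, metis mod_add_self2)
    then show "r \<in> death k e"
      unfolding death_def by blast
  next
    assume "r \<in> death k e"
    then obtain m where "dies_at (k + n) e (m + n)" "r = (m + n) mod n"
      unfolding death_def by (auto simp: dies_at_shift)
    then show "r \<in> death (k + n) e"
      unfolding death_def by blast
  qed
  then show "death (k + n) e = death k e"
    by blast
qed

lemma death_cong: "tet k = tet l \<Longrightarrow> death k = death l"
  using periodic_from_cong[of 0 death n k l] by (simp add: death_periodic tet_eq_iff)

text \<open>An edge that passes upwards is not the bottom diagonal of layer \<open>k\<close>, so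
  starting the search one layer later changes nothing.\<close>

lemma death_up_step:
  assumes "up_step k e e'"
  shows "death k e = death (Suc k) e'"
proof -
  note up = up_stepD[OF assms]
  have ne: "bottom_slope k \<noteq> slope (p k) e"
    using slope_eq_bottom[OF layer up(1)] up(4) by metis
  have "dies_at k e m \<longleftrightarrow> dies_at (Suc k) e' m" for m
    unfolding dies_at_def up(3) using ne by (metis Suc_leD Suc_leI le_neq_implies_less)
  then show ?thesis
    unfolding death_def by simp
qed

lemma death_bottom: "death k (B k) = {k mod n}"
proof -
  have "dies_at k (B k) m \<longleftrightarrow> m = k" for m
    unfolding dies_at_def by (metis le_neq_implies_less le_refl leD)
  then show ?thesis
    unfolding death_def by auto
qed

text \<open>\<open>death\<close> is constant on an edge class, and at a bottom diagonal it names the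
  layer.\<close>

lemma unique_bottom_in_edge:
  assumes "E \<in> edges \<Gamma>" "(tet k, B k) \<in> E" "(tet l, B l) \<in> E"
  shows "tet k = tet l"
proof -
  \<comment> \<open>\<open>inv tet\<close> picks some index of the tetrahedron; by
    \<open>death_cong\<close> any index gives the same value.\<close>
  define f where "f = (\<lambda>(t, e). death (inv tet t) e)"
  have f: "f (tet k, e) = death k e" for k e
    unfolding f_def using death_cong[of "inv tet (tet k)" k] by (simp add: f_inv_into_f)
  have "f (tet k, B k) = f (tet l, B l)"
    by (rule edge_invariant[OF _ assms]) (simp add: f death_up_step)
  then show ?thesis
    by (simp add: f death_bottom tet_eq_iff)
qed


section \<open>Angles from bending\<close>

text \<open>
  The torus between the tetrahedra \<open>k\<close> and \<open>k + 1\<close> has the three edges \<open>top_slope k\<close>,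
  \<open>bottom_slope (k + 1)\<close> and \<open>third_slope k\<close>.
\<close>

definition third_slope :: "nat \<Rightarrow> (int ^ 2) set" where
  "third_slope k = the_elem (sides k \<inter> sides (Suc k))"

text \<open>Of the three slopes of the torus, omitting the one just created leaves the sides of
  layer \<open>k\<close>, and omitting the one about to be removed leaves those of the next
  layer.\<close>

lemma sides_third_slope:
  assumes "top_slope k \<noteq> bottom_slope (Suc k)"
  shows "sides k = {bottom_slope (Suc k), third_slope k}"
    and "sides (Suc k) = {top_slope k, third_slope k}"
    and "third_slope k \<noteq> bottom_slope (Suc k)" and "third_slope k \<noteq> top_slope k"
proof -
  note notin = diagonal_slopes_notin_side_slopes[OF layer]
  have "bottom_slope (Suc k) \<in> sides k" "top_slope k \<in> sides (Suc k)"
    using sides_step[of k] assms by blast+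
  then obtain c c' where c: "sides k = {bottom_slope (Suc k), c}" "c \<noteq> bottom_slope (Suc k)"
    and c': "sides (Suc k) = {top_slope k, c'}" "c' \<noteq> top_slope k"
    using card_side_slopes[OF layer, of k] card_side_slopes[OF layer, of "Suc k"]
    unfolding card_2_iff by (metis doubleton_eq_iff insertE singletonD)
  have "c \<noteq> top_slope k" "c' \<noteq> bottom_slope (Suc k)"
    using notin(2)[of k] notin(1)[of "Suc k"] unfolding c c' by auto
  moreover have "c \<in> insert (bottom_slope (Suc k)) (sides (Suc k))"
    using sides_step[of k] c(1) by blast
  ultimately have "c' = c"
    using c' c(2) by simp
  then have "sides k \<inter> sides (Suc k) = {c}"
    unfolding c(1) c'(1) using assms by auto
  then have "third_slope k = c"
    by (simp add: third_slope_def)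
  then show "sides k = {bottom_slope (Suc k), third_slope k}"
    "sides (Suc k) = {top_slope k, third_slope k}"
    "third_slope k \<noteq> bottom_slope (Suc k)" "third_slope k \<noteq> top_slope k"
    using c c' \<open>c' = c\<close> by simp_all
qed

text \<open>
  \<open>bend k\<close> is the exterior dihedral angle at the two diagonals of tetrahedron \<open>k\<close>.  If
  \<open>top_slope k = bottom_slope (k + 2)\<close>, the side angles of tetrahedron \<open>k + 1\<close> are positive iff
  \<open>bend k + bend (k + 2) < 2 * bend (k + 1)\<close>; otherwise (at a hinge), iff
  \<open>\<bar>bend (k + 2) - bend k\<bar> < bend (k + 1)\<close>.  Restarting the increasing concave sequence
  \<open>2 - (1/2)^m\<close> at each hinge achieves both.
\<close>

primrec bend :: "nat \<Rightarrow> real" where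
  "bend 0 = 1"
| "bend (Suc k) = (if top_slope k = bottom_slope (Suc (Suc k)) then 1 + bend k / 2 else 1)"

text \<open>The dihedral angle accumulated below the edge \<open>s\<close> of the torus between \<open>k\<close> and \<open>k + 1\<close>.\<close>

definition pleat :: "nat \<Rightarrow> (int ^ 2) set \<Rightarrow> real" where
  "pleat k s = (if s = bottom_slope (Suc k) then pi + bend (Suc k)
     else if s = top_slope k then pi - bend k
     else pi + bend k - bend (Suc k))"

text \<open>
  \<open>ang k\<close> is the angle in tetrahedron \<open>k + 1\<close>, written as half the sum of a contribution of each
  of the two faces (opposite \<open>v\<close>) meeting at \<open>e\<close>.  The contributions cancel under the gluing.
\<close>

definition flag :: "nat \<Rightarrow> vertex \<Rightarrow> vertex set \<Rightarrow> real" where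
  "flag k v e = (if v \<in> B (Suc k) then pleat (Suc k) (slope (p (Suc k)) e)
     else - pleat k (slope (p (Suc k)) e))"

definition ang :: "nat \<Rightarrow> vertex set \<Rightarrow> real" where
  "ang k e = (\<Sum>v\<in>- e. flag k v e) / 2 + (if e = B (Suc k) then 2 * pi else 0)"

lemma bend_bounds: "1 \<le> bend k" "bend k < 2"
  by (induction k) auto

lemma flag_glue:
  assumes "v \<in> B (Suc k)" "v \<notin> e" "e \<in> tet_edges" "glue \<Gamma> (tet (Suc k)) v = (t', \<sigma>)"
  shows "flag (Suc k) (\<sigma> v) (\<sigma> ` e) = - flag k v e"
  using up_glueD[OF assms(1,4)] assms unfolding flag_def by simp

text \<open>Both faces here are bottom faces, so the flags contribute minus the angle already
  accumulated below; the extra \<open>2 * pi\<close> in \<open>ang\<close> leaves what completes a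
  full turn.\<close>

lemma ang_bottom: "ang k (B (Suc k)) = pi - bend (Suc k)"
proof -
  have "card (- B (Suc k)) = 2"
    using layer_tet_diagonals(2)[OF layer] by (simp add: tet_edges_def)
  moreover have "(\<Sum>v\<in>- B (Suc k). flag k v (B (Suc k))) = (\<Sum>v\<in>- B (Suc k). - (pi + bend (Suc k)))"
    by (rule sum.cong) (simp_all add: flag_def pleat_def del: bend.simps)
  ultimately show ?thesis
    unfolding ang_def by (simp add: algebra_simps del: bend.simps)
qed

lemma ang_top:
  assumes "top_slope (Suc k) \<noteq> bottom_slope (Suc (Suc k))"
  shows "ang k (- B (Suc k)) = pi - bend (Suc k)"
proof -
  have "card (B (Suc k)) = 2"
    using layer_tet_diagonals(1)[OF layer] by (simp add: tet_edges_def)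
  moreover have "(\<Sum>v\<in>B (Suc k). flag k v (- B (Suc k))) = (\<Sum>v\<in>B (Suc k). pi - bend (Suc k))"
    using assms by (intro sum.cong) (simp_all add: flag_def pleat_def del: bend.simps)
  moreover have "- B (Suc k) \<noteq> B (Suc k)"
    using B_ne_compl[OF refl] by metis
  ultimately show ?thesis
    unfolding ang_def by (simp del: bend.simps)
qed

text \<open>A side lies in one top and one bottom face. It carries half of the growth of the pleat,
  the other half going to the opposite side of the same slope.\<close>

lemma ang_side:
  assumes "e \<in> tet_edges" "e \<noteq> B (Suc k)" "e \<noteq> - B (Suc k)"
  shows "ang k e = (pleat (Suc k) (slope (p (Suc k)) e) - pleat k (slope (p (Suc k)) e)) / 2"
proof -
  let ?B = "B (Suc k)"
  have "card (- e) = 2"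
    using compl_tet_edges[OF assms(1)] by (simp add: tet_edges_def)
  moreover have "card ?B = 2" "card (- ?B) = 2"
    using layer_tet_diagonals[OF layer, of "Suc k"] by (simp_all add: tet_edges_def)
  \<comment> \<open>An inclusion between two-element sets would be an equality and make
    \<open>e\<close> a diagonal.\<close>
  ultimately have "\<not> - e \<subseteq> ?B" "\<not> - e \<subseteq> - ?B"
    using assms(2,3) by (metis card_subset_eq double_compl finite)+
  then obtain x y where xy: "x \<notin> e" "y \<notin> e" "x \<in> ?B" "y \<notin> ?B"
    by blast
  then have "x \<noteq> y"
    by blast
  then have "- e = {x, y}"
    using xy \<open>card (- e) = 2\<close> by (intro card_seteq[symmetric]) simp_all
  then show ?thesis
    unfolding ang_def using xy(3,4) \<open>x \<noteq> y\<close> assms(2) by (simp add: flag_def)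
qed

end

text \<open>The flips trace a path in the tree of ideal triangulations of the punctured torus:
  \<open>no_backtrack\<close> makes it geodesic, and at a hinge the slope around which it pivots
  changes.\<close>

locale geodesic_layering = layered_torus +
  fixes h :: nat
  assumes no_backtrack: "top_slope k \<noteq> bottom_slope (Suc k)"
    and hinge: "top_slope h \<noteq> bottom_slope (Suc (Suc h))"
begin

section \<open>Positivity and the angle sum in each tetrahedron\<close>

lemmas sides_eq = sides_third_slope[OF no_backtrack]

lemma pleat_simps:
  "pleat k (bottom_slope (Suc k)) = pi + bend (Suc k)"
  "pleat k (top_slope k) = pi - bend k"
  "pleat k (third_slope k) = pi + bend k - bend (Suc k)"
  using no_backtrack[of k] sides_eq[of k] by (simp_all add: pleat_def del: bend.simps)

lemma pleat_increasing:
  assumes "s \<in> sides (Suc k)"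
  shows "pleat k s < pleat (Suc k) s"
proof (cases "top_slope k = bottom_slope (Suc (Suc k))")
  \<comment> \<open>The third slope persists. For it the claim is
    \<open>bend k + bend (k + 2) < 2 * bend (k + 1)\<close>, which the recursion turns into
    \<open>bend (k + 2) < 2\<close>.\<close>
  case True
  then have third: "third_slope (Suc k) = third_slope k"
    using sides_eq(1,3)[of "Suc k"] sides_eq(2,4)[of k] by (auto simp: doubleton_eq_iff)
  have "bend (Suc k) = 1 + bend k / 2"
    using True by simp
  then have "pleat k (third_slope k) < pleat (Suc k) (third_slope (Suc k))"
    using bend_bounds[of "Suc (Suc k)"] by (simp add: pleat_simps del: bend.simps)
  moreover have "pleat k (top_slope k) < pleat (Suc k) (bottom_slope (Suc (Suc k)))"
    using bend_bounds[of "Suc (Suc k)"] bend_bounds[of k] by (simp add: pleat_simps del: bend.simps)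
  moreover have "s = top_slope k \<or> s = third_slope k"
    using assms sides_eq(2)[of k] by simp
  ultimately show ?thesis
    using True third by metis
next
  \<comment> \<open>The third slope becomes the one removed next, and the new edge becomes the third
    one. As \<open>bend (Suc k) = 1\<close>, it suffices that \<open>bend k\<close> and
    \<open>bend (k + 2)\<close> differ by less than 1, and both lie in [1, 2).\<close>
  case False
  then have third: "third_slope (Suc k) = top_slope k" "third_slope k = bottom_slope (Suc (Suc k))"
    using sides_eq(1)[of "Suc k"] sides_eq(2)[of k] by (auto simp: doubleton_eq_iff)
  have "bend (Suc k) = 1"
    using False by simp
  then have "pleat k (top_slope k) < pleat (Suc k) (third_slope (Suc k))"
    "pleat k (third_slope k) < pleat (Suc k) (bottom_slope (Suc (Suc k)))"
    using bend_bounds[of "Suc (Suc k)"] bend_bounds[of k]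
    by (simp_all add: pleat_simps del: bend.simps)
  moreover have "s = top_slope k \<or> s = third_slope k"
    using assms sides_eq(2)[of k] by simp
  ultimately show ?thesis
    using third by metis
qed

text \<open>Half of this is the sum of the two side angles, which complements the diagonal angle
  \<open>pi - bend (Suc k)\<close> to \<open>pi\<close>.\<close>

lemma sum_pleat_sides:
  "(\<Sum>s\<in>sides (Suc k). pleat (Suc k) s - pleat k s) = 2 * bend (Suc k)"
proof -
  have "(\<Sum>s\<in>sides (Suc k). pleat (Suc k) s) = 2 * pi + bend (Suc k)"
    unfolding sides_eq(1)[of "Suc k"] using sides_eq(3)[of "Suc k"]
    by (subst sum.insert) (auto simp: pleat_simps simp del: bend.simps)
  moreover have "(\<Sum>s\<in>sides (Suc k). pleat k s) = 2 * pi - bend (Suc k)"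
    unfolding sides_eq(2)[of k] using sides_eq(4)[of k]
    by (subst sum.insert) (auto simp: pleat_simps simp del: bend.simps)
  ultimately show ?thesis
    by (simp add: sum_subtractf del: bend.simps)
qed

lemma ang_pos:
  assumes "e \<in> tet_edges"
  shows "ang k e > 0"
proof -
  have "pi - bend (Suc k) > 0"
    using bend_bounds(2)[of "Suc k"] pi_gt3 by linarith
  moreover have "ang k e > 0" if "e \<noteq> B (Suc k)" "e \<noteq> - B (Suc k)"
  proof -
    have "slope (p (Suc k)) e \<in> sides (Suc k)"
      using assms that unfolding side_slopes_def by blast
    then show ?thesis
      using pleat_increasing unfolding ang_side[OF assms that] by simp
  qed
  ultimately show ?thesis
    using ang_bottom[of k] ang_top[OF no_backtrack, of k] by metis
qed

lemma ang_opposite: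
  assumes "e \<in> tet_edges"
  shows "ang k (- e) = ang k e"
proof -
  have "ang k (- e) = ang k e" if "e \<noteq> B (Suc k)" "e \<noteq> - B (Suc k)"
  proof -
    have "- e \<in> tet_edges"
      using assms by (rule compl_tet_edges)
    moreover have "- e \<noteq> B (Suc k)" "- e \<noteq> - B (Suc k)"
      using that by (metis double_compl)+
    ultimately show ?thesis
      using slope_opposite[OF layer assms that] ang_side[OF assms that] ang_side[of "- e" k] by simp
  qed
  then show ?thesis
    using ang_bottom[of k] ang_top[OF no_backtrack, of k] by (metis double_compl)
qed

lemma ang_sum: "ang k {V0, V1} + ang k {V0, V2} + ang k {V0, V3} = pi"
proof -
  obtain a b c d r s where *: "distinct [a, b, c, d]" "B (Suc k) = {a, c}" "- B (Suc k) = {b, d}"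
    "slope (p (Suc k)) {a, b} = r" "slope (p (Suc k)) {a, d} = s"
    "distinct [r, s, slope (p (Suc k)) {a, c}, slope (p (Suc k)) {b, d}]"
    using layer_tetE[OF layer[of "Suc k"]] by metis
  have E: "{a, b} \<in> tet_edges" "{a, d} \<in> tet_edges"
    using *(1) by (simp_all add: tet_edges_def)
  have ne: "{a, b} \<noteq> B (Suc k)" "{a, b} \<noteq> - B (Suc k)" "{a, d} \<noteq> B (Suc k)" "{a, d} \<noteq> - B (Suc k)"
    using *(1) unfolding *(3) unfolding *(2) by (auto simp: doubleton_eq_iff)
  have "r \<in> sides (Suc k)" "s \<in> sides (Suc k)"
    using E ne *(4,5) unfolding side_slopes_def by blast+
  moreover have "r \<noteq> s"
    using *(6) by simp
  ultimately have sides: "{r, s} = sides (Suc k)"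
    using card_side_slopes[OF layer, of "Suc k"]
    by (intro card_subset_eq card_ge_0_finite) simp_all
  have "ang k {a, b} + ang k {a, d} = (\<Sum>s\<in>{r, s}. pleat (Suc k) s - pleat k s) / 2"
    using \<open>r \<noteq> s\<close> ang_side[OF E(1) ne(1,2)] ang_side[OF E(2) ne(3,4)] by (simp add: *(4,5))
  also have "\<dots> = bend (Suc k)"
    unfolding sides sum_pleat_sides by simp
  finally show ?thesis
    using sum_opposite_edges[of "ang k", OF ang_opposite *(1)] ang_bottom[of k] unfolding *(2) by simp
qed


section \<open>Periodicity beyond a hinge and descent to \<Gamma>\<close>

lemma bend_periodic: "k > h \<Longrightarrow> bend (k + n) = bend k"
proof (induction k)
  case (Suc k)
  have "top_slope (k + n) = bottom_slope (Suc (Suc (k + n))) \<longleftrightarrow>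
      top_slope k = bottom_slope (Suc (Suc k))"
    using bottom_periodic[of "Suc (Suc k)"] by (simp add: top_periodic)
  moreover have "bend (k + n) = bend k" if "k \<noteq> h"
    using Suc that by simp
  \<comment> \<open>At \<open>k = h\<close> the hinge and its translate by \<open>n\<close> both
    reset the value to 1, whatever came before; from there periodicity propagates.\<close>
  ultimately show ?case
    using hinge by (cases "k = h") simp_all
qed simp

lemma flag_periodic:
  assumes "k > h"
  shows "flag (k + n) = flag k"
proof -
  have pleat: "pleat (k + n) (act s) = pleat k s" if "k > h" for k s
    using bend_periodic[OF that] bend_periodic[of "Suc k"] that
      bottom_periodic[of "Suc k"] top_periodic[of k]
    by (simp add: pleat_def del: bend.simps)
  have "flag (k + n) v e = flag k v e" for v e
    using pleat[OF assms] pleat[of "Suc k"] assms B_periodic[of "Suc k"] slope_periodic[of "Suc k"]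
    by (simp add: flag_def)
  then show ?thesis
    by blast
qed

text \<open>\<open>bend\<close> is periodic only from the hinge \<open>h\<close> on.\<close>

definition index :: "'a \<Rightarrow> nat" where
  "index t = (SOME k. k > h \<and> tet (Suc k) = t)"

text \<open>The choice made in \<open>index\<close> is immaterial, so flags depend only on the
  tetrahedron.\<close>

lemma flag_index:
  assumes "k > h"
  shows "flag (index (tet (Suc k))) = flag k"
proof -
  let ?i = "index (tet (Suc k))"
  have "?i > h \<and> tet (Suc ?i) = tet (Suc k)"
    unfolding index_def by (rule someI[of _ k]) (simp add: assms)
  then have "?i \<ge> Suc h" "?i mod n = k mod n"
    by (simp_all add: tet_Suc_eq_iff flip: tet_eq_iff)
  then show ?thesis
    using periodic_from_cong[of "Suc h" flag n ?i k] flag_periodic assms by simp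
qed

lemma index:
  assumes "t \<in> tets \<Gamma>"
  shows "tet (Suc (index t)) = t" "index t > h"
proof -
  have "t \<in> range tet"
    using assms by (simp only: range_tet)
  then obtain l where "t = tet l"
    by (rule rangeE)
  moreover obtain j where "Suc j \<ge> Suc (Suc h)" "tet (Suc j) = tet l"
    by (rule tet_predecessor[of "Suc (Suc h)" l])
  ultimately have "j > h \<and> tet (Suc j) = t"
    by simp
  then have "index t > h \<and> tet (Suc (index t)) = t"
    unfolding index_def by (rule someI)
  then show "tet (Suc (index t)) = t" "index t > h"
    by simp_all
qed

section \<open>Edge equations by cancellation across faces\<close>

definition glue_flag :: "('a \<times> vertex set) \<times> vertex \<Rightarrow> ('a \<times> vertex set) \<times> vertex" where
  "glue_flag = (\<lambda>((t, e), v). case glue \<Gamma> t v of (t', \<sigma>) \<Rightarrow> ((t', \<sigma> ` e), \<sigma> v))"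

lemma glue_flag_involution:
  assumes "t \<in> tets \<Gamma>"
  shows "glue_flag (glue_flag ((t, e), v)) = ((t, e), v)"
proof -
  obtain t' \<sigma> where g: "glue \<Gamma> t v = (t', \<sigma>)"
    by fastforce
  then show ?thesis
    using glue_pairing[OF assms g]
    by (simp add: glue_flag_def inv_f_f bij_is_inj image_comp)
qed

text \<open>Across a top face this is \<open>flag_glue\<close>; across a bottom face it is the same
  crossing read backwards, by the involution.\<close>

lemma flag_glue_flag:
  assumes "t \<in> tets \<Gamma>" "e \<in> tet_edges" "v \<notin> e" "glue_flag ((t, e), v) = ((t', e'), v')"
  shows "flag (index t') v' e' = - flag (index t) v e"
proof -
  have up: "flag (index t') v' e' = - flag (index t) v e"
    if asm: "t = tet (Suc k)" "k > h" "v \<in> B (Suc k)" "e \<in> tet_edges" "v \<notin> e"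
      "glue_flag ((t, e), v) = ((t', e'), v')" for t e v t' e' v' k
  proof -
    obtain \<sigma> where g: "glue \<Gamma> (tet (Suc k)) v = (t', \<sigma>)" "e' = \<sigma> ` e" "v' = \<sigma> v"
      using asm(6) unfolding glue_flag_def asm(1) by (auto split: prod.splits)
    have "t' = tet (Suc (Suc k))"
      using up_glueD(1)[OF asm(3) g(1)] .
    then show ?thesis
      using flag_glue[OF asm(3,5,4) g(1)] flag_index[of k] flag_index[of "Suc k"] asm(1,2) g(2,3)
      by simp
  qed
  \<comment> \<open>One layer more than usual, so that the predecessor of \<open>k\<close> is still
    beyond the hinge.\<close>
  obtain k where k: "t = tet (Suc k)" "k > Suc h"
  proof -
    obtain j where "Suc j \<ge> Suc (Suc (Suc h))" "tet (Suc j) = tet (Suc (index t))"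
      by (rule tet_predecessor[of "Suc (Suc (Suc h))" "Suc (index t)"])
    then show thesis
      using index(1)[OF assms(1)] by (intro that[of j]) simp_all
  qed
  show ?thesis
  proof (cases "v \<in> B (Suc k)")
    case True
    then show ?thesis
      using up[of t k v e] k assms by simp
  next
    case False
    obtain j where j: "k = Suc j" "j > h"
      using k(2) by (metis Suc_less_eq Suc_lessE)
    obtain u \<tau> where u: "u \<in> B k" "glue \<Gamma> (tet k) u = (tet (Suc k), \<tau>)" "\<tau> u = v"
      using bottom_face_is_glued_up[OF False] .
    have "glue \<Gamma> t v = (tet k, inv \<tau>)"
      using glue_pairing(3)[OF tet_in_tets u(2)] u(3) k(1) by simp
    then have t': "t' = tet k" "e' = inv \<tau> ` e" "v' = inv \<tau> v"
      using assms(4) unfolding glue_flag_def by simp_all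
    have \<tau>: "bij \<tau>"
      using glue_pairing(2)[OF tet_in_tets u(2)] .
    then have v': "v' = u"
      using t'(3) u(3) by (metis bij_is_inj inv_f_f)
    have "u \<notin> e'"
      using \<tau> assms(3) u(3) unfolding t'(2)
      by (metis bij_inv_eq_iff imageE)
    moreover have "e' \<in> tet_edges"
      using assms(2) \<tau> by (simp add: t'(2) image_tet_edges bij_imp_bij_inv)
    moreover have "glue_flag ((t', e'), v') = ((t, e), v)"
      using glue_flag_involution[OF assms(1), of e v] assms(4) by simp
    ultimately have "flag (index t) v e = - flag (index t') v' e'"
      using up[of t' j v' e' t e v] j u(1) t'(1) v' by simp
    then show ?thesis
      by simp
  qed
qed

definition angle :: "'a \<Rightarrow> vertex set \<Rightarrow> real" where
  "angle t = ang (index t)"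

text \<open>Crossing faces permutes the flags at \<open>E\<close> and negates their contributions,
  so the sum equals its own negative.\<close>

lemma sum_flags_edge:
  assumes E: "E \<in> edges \<Gamma>"
  shows "(\<Sum>((t, e), v)\<in>Sigma E (\<lambda>(t, e). - e). flag (index t) v e) = 0"
proof -
  define F where "F = Sigma E (\<lambda>(t, e :: vertex set). - e)"
  define f where "f = (\<lambda>((t, e), v). flag (index t) v e)"
  have F: "t \<in> tets \<Gamma> \<and> e \<in> tet_edges \<and> v \<notin> e" if "((t, e), v) \<in> F" for t e v
    using that edge_subset[OF E] unfolding F_def by auto
  have closed: "glue_flag x \<in> F" if "x \<in> F" for x
  proof -
    obtain t e v where x: "x = ((t, e), v)"
      by (metis surj_pair)
    obtain t' \<sigma> where g: "glue \<Gamma> t v = (t', \<sigma>)"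
      by fastforce
    have t: "t \<in> tets \<Gamma>" "e \<in> tet_edges" "v \<notin> e"
      using F that x by blast+
    have "((t, e), (t', \<sigma> ` e)) \<in> edge_glue \<Gamma>"
      unfolding edge_glue_def
      by (intro CollectI exI[of _ t] exI[of _ e] exI[of _ t'] exI[of _ \<sigma>] exI[of _ v])
        (simp add: t g)
    moreover have "(t, e) \<in> E"
      using that unfolding x F_def by simp
    ultimately have "(t', \<sigma> ` e) \<in> E"
      using edge_closed[OF E] by blast
    moreover have "\<sigma> v \<notin> \<sigma> ` e"
      using glue_pairing(2)[OF t(1) g] t(3) by (simp add: bij_is_inj inj_image_mem_iff)
    ultimately show ?thesis
      by (simp add: x F_def glue_flag_def g)
  qed
  have invol: "glue_flag (glue_flag x) = x" if "x \<in> F" for x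
    using F glue_flag_involution that by (metis surj_pair)
  have anti: "f (glue_flag x) = - f x" if "x \<in> F" for x
  proof -
    obtain t e v t' e' v' where x: "x = ((t, e), v)" "glue_flag x = ((t', e'), v')"
      by (metis surj_pair)
    then show ?thesis
      using flag_glue_flag[of t e v t' e' v'] F that by (simp add: f_def)
  qed
  have "sum f F = sum (\<lambda>x. - f x) F"
    by (rule sum.reindex_bij_witness[of _ glue_flag glue_flag]) (simp_all add: closed invol anti)
  then have "sum f F = 0"
    by (simp add: sum_negf)
  then show ?thesis
    by (simp add: F_def f_def)
qed

text \<open>The flags cancel, leaving \<open>2 * pi\<close> for each bottom diagonal in
  \<open>E\<close>. There is at least one because the angles are positive, and at most one by
  \<open>unique_bottom_in_edge\<close>.\<close>

lemma sum_angle_edge: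
  assumes E: "E \<in> edges \<Gamma>"
  shows "(\<Sum>(t, e)\<in>E. angle t e) = 2 * pi"
proof -
  define D where "D = {(t, e) \<in> E. e = B (Suc (index t))}"
  have fin: "finite E"
    using finite_edge[OF E] .
  have "(\<Sum>(t, e)\<in>E. angle t e)
      = (\<Sum>(t, e)\<in>E. \<Sum>v\<in>- e. flag (index t) v e) / 2
        + (\<Sum>x\<in>E. if x \<in> D then 2 * pi else 0)"
    unfolding sum_divide_distrib sum.distrib[symmetric]
  proof (rule sum.cong)
    fix x assume "x \<in> E"
    moreover obtain t e where "x = (t, e)"
      by fastforce
    ultimately show "(case x of (t, e) \<Rightarrow> angle t e)
        = (case x of (t, e) \<Rightarrow> \<Sum>v\<in>- e. flag (index t) v e) / 2 + (if x \<in> D then 2 * pi else 0)"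
      by (simp add: angle_def ang_def D_def)
  qed simp
  also have "(\<Sum>(t, e)\<in>E. \<Sum>v\<in>- e. flag (index t) v e)
      = (\<Sum>((t, e), v)\<in>Sigma E (\<lambda>(t, e). - e). flag (index t) v e)"
    by (subst sum.Sigma[symmetric]) (auto simp: fin case_prod_unfold)
  also have "\<dots> = 0"
    by (rule sum_flags_edge[OF E])
  also have "(\<Sum>x\<in>E. if x \<in> D then 2 * pi else 0) = 2 * pi * card D"
  proof -
    have "E \<inter> D = D"
      by (auto simp: D_def)
    then show ?thesis
      using sum.inter_restrict[OF fin, of "\<lambda>_. 2 * pi" D] by (simp add: mult.commute)
  qed
  finally have sum: "(\<Sum>(t, e)\<in>E. angle t e) = 2 * pi * card D"
    by simp
  have "E \<noteq> {}"
    using E by (auto elim!: edgesE)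
  moreover have "(case x of (t, e) \<Rightarrow> angle t e) > 0" if "x \<in> E" for x
    using that edge_subset[OF E] ang_pos by (auto simp: angle_def)
  ultimately have "(\<Sum>(t, e)\<in>E. angle t e) > 0"
    using fin by (intro sum_pos) simp_all
  then have "card D > 0"
    using sum by (auto intro: gr0I)
  moreover have "x = y" if xy: "x \<in> D" "y \<in> D" for x y
  proof -
    obtain t t' where t: "x = (t, B (Suc (index t)))" "y = (t', B (Suc (index t')))" "x \<in> E" "y \<in> E"
      using xy unfolding D_def by blast
    then have "t \<in> tets \<Gamma>" "t' \<in> tets \<Gamma>"
      using edge_subset[OF E] by auto
    then have "t = t'"
      using unique_bottom_in_edge[OF E, of "Suc (index t)" "Suc (index t')"] t index(1) by simp
    then show ?thesis
      by (simp add: t)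
  qed
  ultimately have "card D = 1"
    by (metis One_nat_def card_1_singleton_iff card_gt_0_iff is_singletonI' is_singleton_altdef)
  then show ?thesis
    using sum by simp
qed

lemma angle_structure_angle: "angle_structure \<Gamma> angle"
  unfolding angle_structure_def
  by (intro conjI ballI sum_angle_edge)
    (simp_all add: angle_def ang_pos ang_opposite ang_sum)

end

section \<open>The trace condition forces a hinge\<close>

lemma (in layered_torus) hinge_exists:
  assumes nb: "\<And>k. top_slope k \<noteq> bottom_slope (Suc k)" and tr: "\<bar>trace A\<bar> > 2"
  shows "\<exists>h. top_slope h \<noteq> bottom_slope (Suc (Suc h))"
proof (rule ccontr)
  assume "\<not> ?thesis"
  then have no_hinge: "top_slope k = bottom_slope (Suc (Suc k))" for k
    by blast
  note sides_eq = sides_third_slope[OF nb]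
  \<comment> \<open>Without a hinge the path pivots forever around one slope, which the monodromy
    must then fix.\<close>
  have step: "third_slope (Suc k) = third_slope k" for k
    using sides_eq(1,3)[of "Suc k"] sides_eq(2,4)[of k] no_hinge[of k]
    by (auto simp: doubleton_eq_iff)
  have const: "third_slope k = third_slope 0" for k
    by (induction k) (simp_all add: step)
  have "third_slope 0 \<in> sides 0"
    using sides_eq(1)[of 0] by simp
  then obtain x where x: "x \<noteq> 0" "third_slope 0 = {x, - x}"
    using side_slopes_nonzero[OF layer] by blast
  have "act (third_slope 0) \<in> sides n"
    using sides_periodic[of 0] \<open>third_slope 0 \<in> sides 0\<close> by simp
  \<comment> \<open>That slope is the image of \<open>bottom_slope 1\<close>, which differs from the
    third slope.\<close>
  moreover have "act (third_slope 0) \<noteq> bottom_slope (Suc n)"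
    using sides_eq(3)[of 0] bottom_periodic[of 1] by simp
  ultimately have "act (third_slope 0) = third_slope 0"
    using sides_eq(1)[of n] const[of n] by simp
  then have "A *v x \<in> {x, - x}"
    unfolding x(2) act_def by blast
  then obtain c :: int where c: "c = 1 \<or> c = - 1" "A *v x = c *s x"
    by (auto intro: that[of 1] that[of "-1"] simp: vec_eq_iff)
  have eqs: "(A $ 1 $ 1 - c) * x $ 1 + A $ 1 $ 2 * x $ 2 = 0"
    "A $ 2 $ 1 * x $ 1 + (A $ 2 $ 2 - c) * x $ 2 = 0"
    using c(2) by (auto simp: vec_eq_iff forall_2 matrix_vector_mult_def sum_2 algebra_simps)
  \<comment> \<open>The determinant of \<open>A\<close> minus \<open>c\<close> times the identity;
    the equations below apply the adjugate to \<open>eqs\<close>, and the nonzero vector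
    \<open>x\<close> makes \<open>?d\<close> vanish.\<close>
  let ?d = "(A $ 1 $ 1 - c) * (A $ 2 $ 2 - c) - A $ 1 $ 2 * A $ 2 $ 1"
  have "?d * x $ 1 = (A $ 2 $ 2 - c) * ((A $ 1 $ 1 - c) * x $ 1 + A $ 1 $ 2 * x $ 2)
      - A $ 1 $ 2 * (A $ 2 $ 1 * x $ 1 + (A $ 2 $ 2 - c) * x $ 2)"
    "?d * x $ 2 = (A $ 1 $ 1 - c) * (A $ 2 $ 1 * x $ 1 + (A $ 2 $ 2 - c) * x $ 2)
      - A $ 2 $ 1 * ((A $ 1 $ 1 - c) * x $ 1 + A $ 1 $ 2 * x $ 2)"
    by (simp_all add: algebra_simps)
  then have "?d * x $ 1 = 0" "?d * x $ 2 = 0"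
    unfolding eqs by simp_all
  moreover have "x $ 1 \<noteq> 0 \<or> x $ 2 \<noteq> 0"
    using x(1) by (auto simp: vec_eq_iff forall_2)
  ultimately have "?d = 0"
    by auto
  moreover have "?d = det A - c * trace A + c * c"
    by (simp add: det_2 trace_def sum_2 algebra_simps)
  ultimately have "c * trace A = 2"
    using c(1) det_A by auto
  then show False
    using c(1) tr by auto
qed

section \<open>Unrolling by powers of the monodromy\<close>

lemma layered_torus_unrolling:
  assumes "det A = 1" "layered_bundle_triangulation A \<Gamma>"
  shows "\<exists>n tet p B. layered_torus \<Gamma> n tet p B A"
proof -
  have pairing: "face_pairing \<Gamma>"
    using assms(2) by (simp add: layered_bundle_triangulation_def)
  obtain n :: nat and tet p B where n: "n > 0" and tet: "bij_betw tet {..<n} (tets \<Gamma>)"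
    and layer: "\<forall>i<n. layer_tet (p i) (B i)"
    and wrap: "tet n = tet 0" "B n = B 0" "\<forall>x. p n x = A *v p 0 x"
    and glue: "\<forall>i<n. \<forall>v \<in> B i. \<exists>\<sigma> w. glue \<Gamma> (tet i) v = (tet (Suc i), \<sigma>) \<and> \<sigma> v \<notin> B (Suc i) \<and>
           (\<forall>x. x \<noteq> v \<longrightarrow> p (Suc i) (\<sigma> x) = p i x + w)"
    using assms(2) unfolding layered_bundle_triangulation_def by (elim conjE exE) (rule that)
  define A' where "A' k = ((*v) A) ^^ k" for k :: nat
  \<comment> \<open>Each completed turn through the \<open>n\<close> layers applies \<open>A\<close>
    once more.\<close>
  define P where "P k x = A' (k div n) (p (k mod n) x)" for k x
  have A'_add: "A' k (x + y) = A' k x + A' k y" for k x y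
    by (induction k) (simp_all add: A'_def matrix_vector_right_distrib)
  have A'_Suc: "A' (Suc k) x = A *v A' k x" for k x
    by (simp add: A'_def)
  have A'_Suc2: "A' (Suc k) x = A' k (A *v x)" for k x
    by (simp add: A'_def funpow_swap1)
  have layer': "layer_tet (\<lambda>x. A' k (p i x)) (B i)" if "i < n" for i k
  proof (induction k)
    case 0
    show ?case
      using layer that by (simp add: A'_def)
  next
    case (Suc k)
    then show ?case
      unfolding A'_Suc using assms(1) by (rule layer_tet_mult)
  qed
  \<comment> \<open>At the end of a turn the closing condition replaces index \<open>n\<close> by
    index 0, and its factor \<open>A\<close> accounts for the larger exponent.\<close>
  have Suc_mod: "tet (Suc k mod n) = tet (Suc (k mod n)) \<and> B (Suc k mod n) = B (Suc (k mod n)) \<and>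
      (\<forall>x. P (Suc k) x = A' (k div n) (p (Suc (k mod n)) x))" for k
  proof (cases "Suc (k mod n) = n")
    case True
    then show ?thesis
      using wrap by (simp add: P_def mod_Suc div_Suc A'_Suc2)
  next
    case False
    then show ?thesis
      by (simp add: P_def mod_Suc div_Suc)
  qed
  have "layered_torus \<Gamma> n (\<lambda>k. tet (k mod n)) P (\<lambda>k. B (k mod n)) A"
  proof
    show "tet (k mod n) = tet (l mod n) \<longleftrightarrow> k mod n = l mod n" for k l
      using tet n by (auto simp: bij_betw_def inj_on_def)
    show "range (\<lambda>k. tet (k mod n)) = tets \<Gamma>"
    proof -
      have "range (\<lambda>k. k mod n) = {..<n}"
      proof
        show "range (\<lambda>k. k mod n) \<subseteq> {..<n}"
          using n by auto
        show "{..<n} \<subseteq> range (\<lambda>k. k mod n)"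
          by (metis lessThan_iff mod_less rangeI subsetI)
      qed
      then show ?thesis
        using tet image_image[of tet "\<lambda>k. k mod n" UNIV] by (simp add: bij_betw_def)
    qed
    show "layer_tet (P k) (B (k mod n))" for k
      using layer'[of "k mod n" "k div n"] n by (simp add: P_def[abs_def])
    show "P (k + n) x = A *v P k x" for k x
      using n by (simp add: P_def A'_Suc)
    show "\<exists>\<sigma> w. glue \<Gamma> (tet (k mod n)) v = (tet (Suc k mod n), \<sigma>) \<and> \<sigma> v \<notin> B (Suc k mod n) \<and>
        (\<forall>x. x \<noteq> v \<longrightarrow> P (Suc k) (\<sigma> x) = P k x + w)" if v: "v \<in> B (k mod n)" for v k
    proof -
      have "k mod n < n"
        using n by simp
      then obtain \<sigma> w where \<sigma>: "glue \<Gamma> (tet (k mod n)) v = (tet (Suc (k mod n)), \<sigma>)"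
        "\<sigma> v \<notin> B (Suc (k mod n))" "\<forall>x. x \<noteq> v \<longrightarrow> p (Suc (k mod n)) (\<sigma> x) = p (k mod n) x + w"
        using glue v by blast
      \<comment> \<open>The translation vector is carried along by the same power of
        \<open>A\<close>.\<close>
      have "P (Suc k) (\<sigma> x) = P k x + A' (k div n) w" if "x \<noteq> v" for x
        using Suc_mod[of k] \<sigma>(3) that by (simp add: P_def[of k] A'_add)
      then show ?thesis
        using \<sigma> Suc_mod[of k] by metis
    qed
  qed (use n pairing assms(1) in simp_all)
  then show ?thesis
    by blast
qed

section \<open>Degree 2 as an obstruction, and the equivalence\<close>

lemma angle_lt_pi:
  assumes "angle_structure \<Gamma> \<theta>" "t \<in> tets \<Gamma>" "e \<in> tet_edges"
  shows "\<theta> t e < pi"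
proof -
  have pos: "\<theta> t e > 0" "\<theta> t (- e) = \<theta> t e" if "e \<in> tet_edges" for e
    using assms(1,2) that unfolding angle_structure_def by blast+
  have sum: "\<theta> t {V0, V1} + \<theta> t {V0, V2} + \<theta> t {V0, V3} = pi"
    using assms(1,2) unfolding angle_structure_def by blast
  have V: "distinct [V0, V1, V2, V3]"
    by simp
  have E: "e \<in> tet_edges" if "e \<in> {{V0, V1}, {V0, V2}, {V0, V3}}" for e
    using that by (auto simp: tet_edges_def)
  have "- {V0, V1} = {V2, V3}" "- {V0, V2} = {V1, V3}" "- {V0, V3} = {V1, V2}"
    unfolding Compl_eq_Diff_UNIV UNIV_vertex by auto
  \<comment> \<open>An edge or its opposite contains \<open>V0\<close>, where three positive angles
    add up to \<open>pi\<close>.\<close>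
  then have "e \<in> {{V0, V1}, {V0, V2}, {V0, V3}} \<or> - e \<in> {{V0, V1}, {V0, V2}, {V0, V3}}"
    using assms(3) unfolding tet_edges_distinct[OF V]
    by (metis (no_types, lifting) double_compl insert_iff empty_iff)
  moreover have "\<theta> t e < pi" if "e \<in> {{V0, V1}, {V0, V2}, {V0, V3}}" for e
  proof -
    have "\<theta> t {V0, V1} > 0" "\<theta> t {V0, V2} > 0" "\<theta> t {V0, V3} > 0"
      by (simp_all add: pos E)
    then show ?thesis
      using that sum by (elim insertE emptyE) simp_all
  qed
  ultimately show ?thesis
    using pos(2)[OF assms(3)] by metis
qed

theorem mainTheorem2:
  fixes A :: "int ^ 2 ^ 2" and \<Gamma> :: "'a triangulation"
  assumes "det A = 1" and "\<bar>trace A\<bar> > 2"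
    and "layered_bundle_triangulation A \<Gamma>"
  shows "(\<exists>\<theta>. angle_structure \<Gamma> \<theta>) \<longleftrightarrow> \<not> (\<exists>E \<in> edges \<Gamma>. edge_degree E = 2)"
proof -
  obtain n tet p B where "layered_torus \<Gamma> n tet p B A"
    using layered_torus_unrolling[OF assms(1,3)] by blast
  then interpret layered_torus \<Gamma> n tet p B A .
  show ?thesis
  proof
    assume "\<exists>\<theta>. angle_structure \<Gamma> \<theta>"
    then obtain \<theta> where \<theta>: "angle_structure \<Gamma> \<theta>"
      by blast
    show "\<not> (\<exists>E \<in> edges \<Gamma>. edge_degree E = 2)"
    proof
      assume "\<exists>E \<in> edges \<Gamma>. edge_degree E = 2"
      then obtain E where E: "E \<in> edges \<Gamma>" "card E = 2"
        unfolding edge_degree_def by blast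
      \<comment> \<open>Two angles below \<open>pi\<close> cannot add up to
        \<open>2 * pi\<close>.\<close>
      have "(\<Sum>(t, e)\<in>E. \<theta> t e) < (\<Sum>x\<in>E. pi)"
      proof (rule sum_strict_mono)
        show "finite E" "E \<noteq> {}"
          using E by (auto simp: finite_edge)
        show "(case x of (t, e) \<Rightarrow> \<theta> t e) < pi" if "x \<in> E" for x
          using that edge_subset[OF E(1)] angle_lt_pi[OF \<theta>] by auto
      qed
      then show False
        using \<theta> E unfolding angle_structure_def by simp
    qed
  next
    assume "\<not> (\<exists>E \<in> edges \<Gamma>. edge_degree E = 2)"
    then have nb: "top_slope k \<noteq> bottom_slope (Suc k)" for k
      using degree_2_edge_if_backtrack by blast
    obtain h where "top_slope h \<noteq> bottom_slope (Suc (Suc h))"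
      using hinge_exists[OF nb assms(2)] by blast
    then interpret geodesic_layering \<Gamma> n tet p B A h
      by unfold_locales (use nb in simp_all)
    show "\<exists>\<theta>. angle_structure \<Gamma> \<theta>"
      using angle_structure_angle by blast
  qed
qed

end
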